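(* Let $p\ge 1$ be a real number, let $f\in L^p(G_m)$, and let $\{q_k:k\in\mathbb{N}\}$ be a non-increasing sequence of nonnegative numbers with $q_0>0$. Then $$\|t_{M_n}f-f\|_p\to 0\quad\text{as } n\to\infty .$$
   Context: $\mathbb{N}=\{0,1,2,\dots\}$. Let $m=(m_0,m_1,\dots)$ be a bounded sequence of integers with $m_k\ge 2$ ($\sup_k m_k<\infty$). $Z_{m_k}=\{0,\dots,m_k-1\}$ is the additive group of integers modulo $m_k$ with discrete topology and uniform probability measure, and $G_m=\prod_{k\ge 0}Z_{m_k}$ is the complete direct product group (product topology, coordinatewise addition), with normalized Haar measure $\mu$ (the product measure). $L^p(G_m)$ is the usual complex Lebesgue space with respect to $\mu$. Put $M_0=1$, $M_{k+1}=m_kM_k$; every $n\in\mathbb{N}$ has a unique expansion $n=\sum_{j\ge0}n_jM_j$ with $n_j\in Z_{m_j}$. Generalized Rademacher functions: $r_k(x)=\exp(2\pi i x_k/m_k)$; Vilenkin functions: $\psi_n(x)=\prod_{k\ge 0}r_k(x)^{n_k}$. For $f\in L^1(G_m)$: $\widehat f(k)=\int_{G_m}f\,\overline{\psi_k}\,d\mu$ and $S_nf=\sum_{k=0}^{n-1}\widehat f(k)\psi_k$. For a nonnegative sequence $\{q_k\}$, $Q_n=\sum_{k=0}^{n-1}q_k$, and the Nörlund means are $t_nf=\frac1{Q_n}\sum_{k=1}^{n}q_{n-k}S_kf$ for $n\ge 1$. *)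

theory Defs
  imports "HOL-Probability.Probability"
begin

text \<open>
  Throughout, \<open>m :: nat \<Rightarrow> nat\<close> is the generating sequence (\<open>m k \<ge> 2\<close>, bounded).
  A point of the Vilenkin group is a function \<open>x :: nat \<Rightarrow> nat\<close> with \<open>x k < m k\<close> for all \<open>k\<close>.
\<close>

text \<open>
  The probability space of the Vilenkin group: the normalized Haar measure is the product of the
  uniform measures.  As the group is a countable product of finite discrete spaces, the product
  sigma-algebra is its Borel sigma-algebra.
\<close>

definition vilenkin_measure :: "(nat \<Rightarrow> nat) \<Rightarrow> (nat \<Rightarrow> nat) measure" where
  "vilenkin_measure m = (\<Pi>\<^sub>M k\<in>UNIV. uniform_count_measure {..<m k})"

primrec vilenkin_M :: "(nat \<Rightarrow> nat) \<Rightarrow> nat \<Rightarrow> nat" where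
  "vilenkin_M m 0 = 1"
| "vilenkin_M m (Suc k) = m k * vilenkin_M m k"

text \<open>
  The digits of \<open>n\<close> in the mixed radix system \<open>m\<close>; the lemmas \<open>vilenkin_digit_expansion\<close> and
  \<open>vilenkin_digit_unique\<close> below show that they form the unique admissible expansion of \<open>n\<close>.
\<close>

definition vilenkin_digit :: "(nat \<Rightarrow> nat) \<Rightarrow> nat \<Rightarrow> nat \<Rightarrow> nat" where
  "vilenkin_digit m n j = (n div vilenkin_M m j) mod m j"

definition rademacher :: "(nat \<Rightarrow> nat) \<Rightarrow> nat \<Rightarrow> (nat \<Rightarrow> nat) \<Rightarrow> complex" where
  "rademacher m k x = exp (2 * of_real pi * \<i> * of_nat (x k) / of_nat (m k))"

text \<open>All but finitely many factors of the following product are \<open>1\<close>.\<close>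

definition vilenkin_fun :: "(nat \<Rightarrow> nat) \<Rightarrow> nat \<Rightarrow> (nat \<Rightarrow> nat) \<Rightarrow> complex" where
  "vilenkin_fun m n x = (\<Prod>k. rademacher m k x ^ vilenkin_digit m n k)"

definition vilenkin_coeff :: "(nat \<Rightarrow> nat) \<Rightarrow> ((nat \<Rightarrow> nat) \<Rightarrow> complex) \<Rightarrow> nat \<Rightarrow> complex" where
  "vilenkin_coeff m f k = (LINT x|vilenkin_measure m. f x * cnj (vilenkin_fun m k x))"

definition vilenkin_partial_sum ::
    "(nat \<Rightarrow> nat) \<Rightarrow> ((nat \<Rightarrow> nat) \<Rightarrow> complex) \<Rightarrow> nat \<Rightarrow> (nat \<Rightarrow> nat) \<Rightarrow> complex" where
  "vilenkin_partial_sum m f n x = (\<Sum>k<n. vilenkin_coeff m f k * vilenkin_fun m k x)"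

definition norlund_mean ::
    "(nat \<Rightarrow> nat) \<Rightarrow> (nat \<Rightarrow> real) \<Rightarrow> ((nat \<Rightarrow> nat) \<Rightarrow> complex) \<Rightarrow> nat \<Rightarrow> (nat \<Rightarrow> nat) \<Rightarrow> complex" where
  "norlund_mean m q f n x =
     1 / of_real (\<Sum>k<n. q k) * (\<Sum>k=1..n. of_real (q (n - k)) * vilenkin_partial_sum m f k x)"

text \<open>
  The Lebesgue space for real \<open>p \<ge> 1\<close>, with functions as representatives of their classes modulo
  null sets.  The seminorm \<open>Lp_norm\<close> has the intended meaning on \<open>Lp_space\<close>; the lemma
  \<open>norlund_diff_in_Lp_space\<close> below ensures that the functions of interest belong to it.
\<close>

definition Lp_space :: "'a measure \<Rightarrow> real \<Rightarrow> ('a \<Rightarrow> complex) set" where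
  "Lp_space M p = {f \<in> borel_measurable M. integrable M (\<lambda>x. norm (f x) powr p)}"

definition Lp_norm :: "'a measure \<Rightarrow> real \<Rightarrow> ('a \<Rightarrow> complex) \<Rightarrow> real" where
  "Lp_norm M p f = (LINT x|M. norm (f x) powr p) powr (1 / p)"


lemma vilenkin_M_pos:
  assumes "\<And>k. m k \<ge> 2"
  shows "vilenkin_M m k > 0"
proof (induction k)
  case (Suc k)
  then show ?case using assms[of k] by simp
qed simp

lemma vilenkin_M_gt:
  assumes "\<And>k. m k \<ge> 2"
  shows "n < vilenkin_M m n"
proof (induction n)
  case (Suc n)
  have "2 * vilenkin_M m n \<le> m n * vilenkin_M m n"
    using assms[of n] by (rule mult_le_mono1)
  then show ?case using Suc unfolding vilenkin_M.simps by linarith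
qed simp

lemma vilenkin_digit_less:
  assumes "\<And>k. m k \<ge> 2"
  shows "vilenkin_digit m n j < m j"
  using assms[of j] by (simp add: vilenkin_digit_def)

lemma vilenkin_digit_eq_0:
  assumes "\<And>k. m k \<ge> 2" and "n \<le> j"
  shows "vilenkin_digit m n j = 0"
proof -
  have "n < vilenkin_M m j"
    using vilenkin_M_gt[of m j] assms by simp
  then show ?thesis by (simp add: vilenkin_digit_def)
qed

lemma vilenkin_digit_partial_expansion:
  "n = (\<Sum>j<N. vilenkin_digit m n j * vilenkin_M m j) + vilenkin_M m N * (n div vilenkin_M m N)"
proof (induction N)
  case (Suc N)
  let ?d = "n div vilenkin_M m N"
  have "?d = vilenkin_digit m n N + m N * (?d div m N)"
    by (simp add: vilenkin_digit_def)
  moreover have "?d div m N = n div vilenkin_M m (Suc N)"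
    by (simp add: div_mult2_eq[symmetric] mult.commute)
  ultimately have d: "?d = vilenkin_digit m n N + m N * (n div vilenkin_M m (Suc N))"
    by (simp only:)
  have "vilenkin_M m N * ?d =
      vilenkin_digit m n N * vilenkin_M m N + vilenkin_M m (Suc N) * (n div vilenkin_M m (Suc N))"
    by (subst d) (simp only: distrib_left vilenkin_M.simps mult_ac)
  with Suc show ?case by simp
qed simp

lemma vilenkin_digit_expansion:
  assumes "\<And>k. m k \<ge> 2"
  shows "n = (\<Sum>j<n. vilenkin_digit m n j * vilenkin_M m j)"
  using vilenkin_digit_partial_expansion[of n m n] vilenkin_M_gt[of m n] assms by simp

lemma vilenkin_digit_unique:
  assumes "\<And>k. m k \<ge> 2" and "\<And>j. a j < m j" and "i < N"
  shows "vilenkin_digit m (\<Sum>j<N. a j * vilenkin_M m j) i = a i"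
  using assms(3)
proof (induction N)
  case (Suc N)
  have less: "(\<Sum>j<K. a j * vilenkin_M m j) < vilenkin_M m K" for K
  proof (induction K)
    case (Suc K)
    have "(\<Sum>j<Suc K. a j * vilenkin_M m j) < (a K + 1) * vilenkin_M m K"
      using Suc by simp
    also have "\<dots> \<le> m K * vilenkin_M m K"
      using assms(2)[of K] by (intro mult_le_mono1) simp
    finally show ?case by simp
  qed simp
  show ?case
  proof (cases "i = N")
    case True
    then show ?thesis
      using less[of N] assms(2)[of N] vilenkin_M_pos[of m N, OF assms(1)]
      by (simp add: vilenkin_digit_def)
  next
    case False
    with Suc.prems have "i < N" by simp
    then have "vilenkin_M m (Suc i) dvd vilenkin_M m N"
    proof (induction N)
      case (Suc N)
      then show ?case by (cases "i = N") (auto intro: dvd_mult)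
    qed simp
    then obtain c where "vilenkin_M m N = vilenkin_M m (Suc i) * c" ..
    then have "a N * vilenkin_M m N = vilenkin_M m i * (m i * (a N * c))"
      by (simp add: mult_ac)
    then have "vilenkin_digit m (\<Sum>j<Suc N. a j * vilenkin_M m j) i =
        (((\<Sum>j<N. a j * vilenkin_M m j) + vilenkin_M m i * (m i * (a N * c))) div vilenkin_M m i)
          mod m i"
      by (simp only: vilenkin_digit_def sum.lessThan_Suc)
    also have "\<dots> = vilenkin_digit m (\<Sum>j<N. a j * vilenkin_M m j) i"
      using vilenkin_M_pos[of m i, OF assms(1)] by (simp add: vilenkin_digit_def)
    finally show ?thesis
      using Suc.IH[OF \<open>i < N\<close>] by simp
  qed
qed simp

lemma vilenkin_fun_eq_prod:
  assumes "\<And>k. m k \<ge> 2"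
  shows "vilenkin_fun m n x = (\<Prod>k<n. rademacher m k x ^ vilenkin_digit m n k)"
  unfolding vilenkin_fun_def
  by (rule prodinf_finite) (auto simp: vilenkin_digit_eq_0[OF assms])

lemma norm_vilenkin_fun:
  assumes "\<And>k. m k \<ge> 2"
  shows "norm (vilenkin_fun m n x) = 1"
proof -
  have "norm (rademacher m k x) = 1" for k
    by (simp add: rademacher_def)
  then show ?thesis
    by (simp add: vilenkin_fun_eq_prod[OF assms] norm_power flip: prod_norm)
qed

lemma prob_space_vilenkin_measure:
  assumes "\<And>k. m k \<ge> 2"
  shows "prob_space (vilenkin_measure m)"
  unfolding vilenkin_measure_def
proof (rule prob_space_PiM)
  fix k
  have "0 < m k" using assms[of k] by simp
  then show "prob_space (uniform_count_measure {..<m k})"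
    by (intro prob_space_uniform_count_measure) auto
qed

lemma measurable_vilenkin_fun [measurable]:
  assumes "\<And>k. m k \<ge> 2"
  shows "vilenkin_fun m n \<in> borel_measurable (vilenkin_measure m)"
proof -
  have "rademacher m k \<in> borel_measurable (vilenkin_measure m)" for k
  proof -
    have "(\<lambda>x. x k) \<in> measurable (vilenkin_measure m) (uniform_count_measure {..<m k})"
      unfolding vilenkin_measure_def by (rule measurable_component_singleton) simp
    moreover have "(\<lambda>i::nat. exp (2 * of_real pi * \<i> * of_nat i / of_nat (m k)) :: complex)
        \<in> borel_measurable (uniform_count_measure {..<m k})"
      by (simp add: measurable_def sets_uniform_count_measure space_uniform_count_measure)
    ultimately show ?thesis
      unfolding rademacher_def by (rule measurable_compose)
  qed
  then show ?thesis
    by (simp add: vilenkin_fun_eq_prod[OF assms, abs_def])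
qed

lemma Lp_space_diff:
  assumes f: "f \<in> Lp_space M p" and g: "g \<in> Lp_space M p" and p: "p \<ge> 1"
  shows "(\<lambda>x. f x - g x) \<in> Lp_space M p"
proof -
  have [measurable]: "f \<in> borel_measurable M" "g \<in> borel_measurable M"
    using f g by (auto simp: Lp_space_def)
  have bound: "norm (a - b) powr p \<le> 2 powr p * (norm a powr p + norm b powr p)"
    for a b :: complex
  proof -
    have "norm (a - b) \<le> 2 * max (norm a) (norm b)"
      using norm_triangle_ineq4[of a b] by simp
    then have "norm (a - b) powr p \<le> (2 * max (norm a) (norm b)) powr p"
      using p by (intro powr_mono2) auto
    also have "\<dots> = 2 powr p * max (norm a) (norm b) powr p"
      by (subst powr_mult) auto
    also have "\<dots> \<le> 2 powr p * (norm a powr p + norm b powr p)"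
      by (intro mult_left_mono) (auto simp: max_def)
    finally show ?thesis .
  qed
  have "integrable M (\<lambda>x. norm (f x - g x) powr p)"
  proof (rule Bochner_Integration.integrable_bound)
    show "integrable M (\<lambda>x. 2 powr p * (norm (f x) powr p + norm (g x) powr p))"
      using f g by (auto simp: Lp_space_def)
  qed (use bound in auto)
  then show ?thesis by (simp add: Lp_space_def)
qed

lemma norlund_diff_in_Lp_space:
  assumes m: "\<And>k. m k \<ge> 2" and p: "p \<ge> 1"
    and f: "f \<in> Lp_space (vilenkin_measure m) p"
  shows "(\<lambda>x. norlund_mean m q f n x - f x) \<in> Lp_space (vilenkin_measure m) p"
proof (rule Lp_space_diff[OF _ f p])
  interpret prob_space "vilenkin_measure m"
    by (rule prob_space_vilenkin_measure[OF m])
  have [measurable]: "vilenkin_fun m k \<in> borel_measurable (vilenkin_measure m)" for k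
    by (rule measurable_vilenkin_fun[OF m])
  have meas [measurable]: "norlund_mean m q f n \<in> borel_measurable (vilenkin_measure m)"
    unfolding norlund_mean_def[abs_def] vilenkin_partial_sum_def by measurable
  define B where "B = norm (1 / of_real (\<Sum>k<n. q k) :: complex) *
      (\<Sum>k=1..n. \<bar>q (n - k)\<bar> * (\<Sum>j<k. norm (vilenkin_coeff m f j)))"
  have "norm (norlund_mean m q f n x) \<le> B" for x
    unfolding norlund_mean_def vilenkin_partial_sum_def B_def norm_mult
    by (intro mult_left_mono sum_norm_le)
       (auto simp: norm_mult norm_vilenkin_fun[OF m] intro!: mult_left_mono sum_norm_le)
  then have "norm (norlund_mean m q f n x) powr p \<le> B powr p" for x
    using p by (intro powr_mono2) auto
  then have "integrable (vilenkin_measure m) (\<lambda>x. norm (norlund_mean m q f n x) powr p)"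
    by (intro integrable_const_bound[where B = "B powr p"]) auto
  with meas show "norlund_mean m q f n \<in> Lp_space (vilenkin_measure m) p"
    by (simp add: Lp_space_def)
qed

end

theory Submission
  imports Defs
begin

text \<open>
  Instead of convolving on the group, all operators are written as integral operators with kernels in
  two variables, starting from \<open>D\<^sub>n(x,y) = (\<Sum>k<n. \<psi>\<^sub>k(x) cnj (\<psi>\<^sub>k(y)))\<close>.  Put
  \<open>F\<^sub>n = (\<Sum>j<n. D\<^sub>j)\<close> and \<open>\<omega>\<^sub>s(x,y) = r\<^sub>s(x) cnj (r\<^sub>s(y))\<close>.  For \<open>r \<le> M\<^sub>s\<close> and
  \<open>b < m\<^sub>s\<close>,
  \<open>F(b M\<^sub>s + r) = F(b M\<^sub>s) + r D(b M\<^sub>s) + \<omega>\<^sub>s\<^sup>b F(r)\<close>, while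
  \<open>(\<Sum>a<m\<^sub>s. \<omega>\<^sub>s\<^sup>a)\<close> is \<open>m\<^sub>s\<close> times the indicator of \<open>x\<^sub>s = y\<^sub>s\<close>, which is independent of
  the earlier coordinates and so does not increase \<open>L\<^sup>1\<close> norms.  As \<open>m\<close> is bounded, this gives
  \<open>\<integral>\<bar>F\<^sub>n(x,y)\<bar> dy \<le> C n\<close>.

  With \<open>N = M\<^sub>n\<close>, the reflection \<open>\<psi>\<^bsub>N-1-i\<^esub> = \<psi>\<^bsub>N-1\<^esub> cnj \<psi>\<^sub>i\<close> turns the kernel of \<open>t\<^sub>N\<close> into
  \<open>D\<^sub>N\<close> minus a unimodular multiple of the conjugate of \<open>(\<Sum>j<N. q\<^sub>j D\<^sub>j) / Q\<^sub>N\<close>; summation by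
  parts, where monotonicity of \<open>q\<close> enters, bounds its \<open>L\<^sup>1\<close> norm uniformly in \<open>N\<close>.  By Schur's test
  the operators \<open>t\<^sub>N\<close> are uniformly bounded on \<open>L\<^sup>p\<close>.  Functions of finitely many coordinates
  are dense in \<open>L\<^sup>p\<close>, and for these convergence is uniform, since all but boundedly many
  partial sums are exact and the remaining ones have weight \<open>O(1/N)\<close>.
\<close>

lemma sum_lessThan_add:
  fixes f :: "nat \<Rightarrow> 'a::comm_monoid_add"
  shows "(\<Sum>k<a + b. f k) = (\<Sum>k<a. f k) + (\<Sum>i<b. f (a + i))"
  by (induction b) (simp_all add: add.assoc)

subsection \<open>Vilenkin functions\<close>

locale vilenkin =
  fixes m :: "nat \<Rightarrow> nat"
  assumes m_ge2: "\<And>k. m k \<ge> 2"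
begin

abbreviation "\<mu> \<equiv> vilenkin_measure m"
abbreviation "M \<equiv> vilenkin_M m"
abbreviation "\<psi> \<equiv> vilenkin_fun m"
abbreviation "\<rho> \<equiv> rademacher m"

sublocale prob_space \<mu>
  by (rule prob_space_vilenkin_measure[OF m_ge2])

lemma m_pos: "m k > 0"
  using m_ge2[of k] by simp

lemma M_pos: "M k > 0"
  by (rule vilenkin_M_pos[OF m_ge2])

lemma M_gt: "n < M n"
  by (rule vilenkin_M_gt[OF m_ge2])

lemma M_dvd: "i \<le> j \<Longrightarrow> M i dvd M j"
  by (induction j) (auto simp: le_Suc_eq)

lemma M_mono: "i \<le> j \<Longrightarrow> M i \<le> M j"
  by (rule dvd_imp_le[OF M_dvd M_pos])

lemma space_vilenkin: "space \<mu> = {y. \<forall>k. y k < m k}"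
  by (auto simp: vilenkin_measure_def space_PiM space_uniform_count_measure PiE_def Pi_def extensional_def)

lemma M_add_less:
  assumes "r < M s" "b < m s"
  shows "b * M s + r < M (Suc s)"
proof -
  have "b * M s + r < Suc b * M s" using assms(1) by simp
  also have "\<dots> \<le> m s * M s" using assms(2) by (intro mult_le_mono1) simp
  finally show ?thesis by simp
qed

lemma digit_eq_0: "n < M N \<Longrightarrow> N \<le> k \<Longrightarrow> vilenkin_digit m n k = 0"
  using M_mono[of N k] by (simp add: vilenkin_digit_def)

lemma vilenkin_fun_prod:
  assumes "n < M N"
  shows "\<psi> n x = (\<Prod>k<N. \<rho> k x ^ vilenkin_digit m n k)"
  unfolding vilenkin_fun_def
  by (rule prodinf_finite) (auto simp: digit_eq_0[OF assms])

text \<open>\<open>b * M s\<close> is a multiple of \<open>M (Suc j)\<close>, hence changes the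
  quotient by \<open>M j\<close> only by a multiple of \<open>m j\<close>.\<close>

lemma digit_add_less:
  assumes "j < s"
  shows "vilenkin_digit m (b * M s + r) j = vilenkin_digit m r j"
proof -
  obtain c where "M s = M (Suc j) * c"
    using M_dvd[of "Suc j" s] assms by (auto simp: dvd_def)
  then have "b * M s + r = r + M j * (m j * (b * c))" by simp
  then have "(b * M s + r) div M j = r div M j + m j * (b * c)"
    using M_pos[of j] by (simp only:) simp
  then show ?thesis by (simp add: vilenkin_digit_def)
qed

text \<open>Adding \<open>b * M s\<close> to \<open>r < M s\<close> places the digit
  \<open>b\<close> at position \<open>s\<close> and leaves the lower digits alone. All kernel
  recursions below rest on this.\<close>

lemma vilenkin_fun_add:
  assumes "r < M s" "b < m s"
  shows "\<psi> (b * M s + r) x = \<rho> s x ^ b * \<psi> r x"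
proof -
  have "vilenkin_digit m (b * M s + r) s = b"
    using assms by (simp add: vilenkin_digit_def)
  then show ?thesis
    using vilenkin_fun_prod[OF M_add_less[OF assms], of x] vilenkin_fun_prod[OF assms(1), of x]
    by (simp add: digit_add_less mult.commute)
qed

text \<open>Every digit of \<open>M s - 1\<close> is the largest possible, so subtracting
  \<open>i\<close> never borrows: at each position the digits of the two indices on the left add up
  to \<open>m j - 1\<close>. The induction splits off the top digit.\<close>

lemma vilenkin_fun_reflect:
  "i < M s \<Longrightarrow> \<psi> (M s - 1 - i) x * \<psi> i x = \<psi> (M s - 1) x"
proof (induction s arbitrary: i)
  case 0
  then show ?case by (simp add: vilenkin_fun_eq_prod[OF m_ge2])
next
  case (Suc s)
  define b r where "b = i div M s" and "r = i mod M s"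
  have r: "r < M s" using M_pos by (simp add: r_def)
  have i: "i = b * M s + r" unfolding b_def r_def by (rule div_mult_mod_eq[symmetric])
  have b: "b < m s"
    using Suc.prems by (simp add: b_def div_less_iff_less_mult[OF M_pos])
  \<comment> \<open>Subtraction on \<open>nat\<close> is truncated, so both index identities are
    first proved in additive form and then cancelled.\<close>
  have "(m s - 1 - b) * M s + (M s - 1 - r) + (i + 1)
      = (m s - 1 - b) * M s + b * M s + ((M s - 1 - r) + r + 1)"
    by (simp only: i ac_simps)
  also have "(M s - 1 - r) + r + 1 = M s"
    using r by linarith
  also have "(m s - 1 - b) * M s + b * M s + M s = ((m s - 1 - b) + (b + 1)) * M s"
    by (simp only: distrib_right mult_1_left add.assoc)
  also have "\<dots> = M (Suc s)" using b by simp
  finally have *: "(m s - 1 - b) * M s + (M s - 1 - r) + (i + 1) = M (Suc s)" .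
  have 1: "M (Suc s) - 1 - i = (m s - 1 - b) * M s + (M s - 1 - r)"
    by (simp only: *[symmetric]) simp
  have "(m s - 1) * M s + (M s - 1) + 1 = ((m s - 1) + 1) * M s"
    using r by (simp add: distrib_right)
  also have "\<dots> = M (Suc s)" using b by simp
  finally have *: "(m s - 1) * M s + (M s - 1) + 1 = M (Suc s)" .
  have 2: "M (Suc s) - 1 = (m s - 1) * M s + (M s - 1)"
    by (simp only: *[symmetric] add_diff_cancel_right')
  have "\<psi> (M (Suc s) - 1 - i) x * \<psi> i x
      = (\<rho> s x ^ (m s - 1 - b) * \<psi> (M s - 1 - r) x) * (\<rho> s x ^ b * \<psi> r x)"
    unfolding 1 using r b by (subst vilenkin_fun_add) (auto simp: i vilenkin_fun_add)
  also have "\<dots> = \<rho> s x ^ (m s - 1 - b + b) * (\<psi> (M s - 1 - r) x * \<psi> r x)"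
    by (simp add: power_add mult_ac)
  also have "\<dots> = \<rho> s x ^ (m s - 1) * \<psi> (M s - 1) x"
    using b Suc.IH[OF r] by simp
  also have "\<dots> = \<psi> (M (Suc s) - 1) x"
    unfolding 2 using r b by (subst vilenkin_fun_add) auto
  finally show ?case .
qed

lemma vilenkin_fun_cnj: "\<psi> n x * cnj (\<psi> n x) = 1"
  using norm_vilenkin_fun[OF m_ge2, where n = n and x = x] by (simp add: complex_norm_square[symmetric])

lemma vilenkin_fun_reflect':
  assumes "i < M s"
  shows "\<psi> (M s - 1 - i) x = \<psi> (M s - 1) x * cnj (\<psi> i x)"
proof -
  have "\<psi> (M s - 1 - i) x * \<psi> i x * cnj (\<psi> i x) = \<psi> (M s - 1) x * cnj (\<psi> i x)"
    by (simp only: vilenkin_fun_reflect[OF assms])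
  then show ?thesis by (simp add: mult.assoc vilenkin_fun_cnj)
qed

subsection \<open>Functions of finitely many coordinates\<close>

text \<open>Cylinder functions, constant on cosets of the subgroup of points whose first
  \<open>s\<close> coordinates vanish. The codomain is left open so that complex kernels and their
  real norms are treated alike.\<close>

definition cyl :: "nat \<Rightarrow> ((nat \<Rightarrow> nat) \<Rightarrow> 'b) \<Rightarrow> bool" where
  "cyl s h \<longleftrightarrow> (\<forall>y\<in>space \<mu>. \<forall>z\<in>space \<mu>. (\<forall>i<s. y i = z i) \<longrightarrow> h y = h z)"

lemma cyl_mono: "cyl s h \<Longrightarrow> s \<le> t \<Longrightarrow> cyl t h"
  unfolding cyl_def by (meson order_less_le_trans)

lemma cyl_const: "cyl s (\<lambda>_. c)"
  by (simp add: cyl_def)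

lemma cyl_comp: "cyl s h \<Longrightarrow> cyl s (\<lambda>y. F (h y))"
  unfolding cyl_def by metis

lemma cyl_comp2: "cyl s h \<Longrightarrow> cyl s g \<Longrightarrow> cyl s (\<lambda>y. F (h y) (g y))"
  unfolding cyl_def by metis

lemma cyl_sum: "(\<And>i. i \<in> I \<Longrightarrow> cyl s (h i)) \<Longrightarrow> cyl s (\<lambda>y. \<Sum>i\<in>I. h i y)"
  unfolding cyl_def by (metis (mono_tags, lifting) sum.cong)

lemma cyl_coord: "i < s \<Longrightarrow> cyl s (\<lambda>y. F (y i))"
  unfolding cyl_def by metis

lemma cyl_vilenkin_fun: "n < M s \<Longrightarrow> cyl s (\<psi> n)"
  unfolding cyl_def by (auto simp: vilenkin_fun_prod rademacher_def)

definition fiber :: "nat \<Rightarrow> (nat \<Rightarrow> nat) \<Rightarrow> (nat \<Rightarrow> nat) set" where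
  "fiber s x = {y \<in> space \<mu>. \<forall>i<s. y i = x i}"

lemma fiber_eq: "x \<in> space \<mu> \<Longrightarrow> fiber s x = {y \<in> space \<mu>. \<forall>i\<in>{..<s}. y i \<in> {x i}}"
  by (auto simp: fiber_def)

text \<open>A fiber prescribes finitely many coordinates, so its measure is the product of the
  \<open>1 / m i\<close> with \<open>i < s\<close>.\<close>

lemma
  assumes "x \<in> space \<mu>"
  shows measure_fiber: "measure \<mu> (fiber s x) = 1 / M s" and sets_fiber: "fiber s x \<in> sets \<mu>"
proof -
  have x: "x i < m i" for i using assms by (simp add: space_vilenkin)
  interpret product_prob_space "\<lambda>k. uniform_count_measure {..<m k}" UNIV
    by (intro product_prob_spaceI prob_space_uniform_count_measure) (use m_pos in auto)
  have s: "{x i} \<in> sets (uniform_count_measure {..<m i})" for i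
    using x by (simp add: sets_uniform_count_measure)
  have em: "emeasure (uniform_count_measure {..<m i}) {x i} = ennreal (1 / m i)" for i
    using x[of i] m_pos[of i]
    by (subst emeasure_uniform_count_measure) (auto simp: ennreal_of_nat_eq_real_of_nat divide_ennreal)
  have "emeasure \<mu> (fiber s x) = (\<Prod>i<s. emeasure (uniform_count_measure {..<m i}) {x i})"
    unfolding fiber_eq[OF assms] unfolding vilenkin_measure_def
    by (rule emeasure_PiM_Collect) (auto simp: s)
  also have "\<dots> = ennreal (\<Prod>i<s. 1 / m i)"
    by (simp add: em prod_ennreal)
  also have "(\<Prod>i<s. 1 / real (m i)) = 1 / M s"
    by (induction s) auto
  finally show "measure \<mu> (fiber s x) = 1 / M s"
    by (simp add: measure_def)
  show "fiber s x \<in> sets \<mu>"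
    unfolding fiber_eq[OF assms] unfolding vilenkin_measure_def
    by (intro sets.sets_Collect_finite_All measurable_sets_Collect[OF measurable_component_singleton])
      (auto simp: sets_uniform_count_measure space_uniform_count_measure)
qed


text \<open>One point from each coset of rank \<open>s\<close>. The default value 0 beyond
  \<open>s\<close> is admissible because every \<open>m i\<close> is positive.\<close>

definition reps :: "nat \<Rightarrow> (nat \<Rightarrow> nat) set" where
  "reps s = PiE_dflt {..<s} 0 (\<lambda>i. {..<m i})"

lemma finite_reps: "finite (reps s)"
  unfolding reps_def by (intro finite_PiE_dflt) auto

lemma reps_space: "z \<in> reps s \<Longrightarrow> z \<in> space \<mu>"
  using m_pos by (auto simp: reps_def PiE_dflt_def space_vilenkin) (metis linorder_not_less)

text \<open>The fibers of the representatives partition the space; \<open>y\<close> lies in that of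
  its truncation \<open>z0\<close>, where \<open>h\<close> has the same value.\<close>

lemma cyl_representation:
  fixes h :: "(nat \<Rightarrow> nat) \<Rightarrow> 'b::real_vector"
  assumes h: "cyl s h" and y: "y \<in> space \<mu>"
  shows "h y = (\<Sum>z\<in>reps s. indicat_real (fiber s z) y *\<^sub>R h z)"
proof -
  define z0 where "z0 = (\<lambda>i. if i < s then y i else 0)"
  have z0: "z0 \<in> reps s"
    using y by (auto simp: reps_def PiE_dflt_def z0_def space_vilenkin)
  have fib: "y \<in> fiber s z \<longleftrightarrow> z = z0" if "z \<in> reps s" for z
    using that y by (fastforce simp: reps_def PiE_dflt_def z0_def fiber_def)
  have "(\<Sum>z\<in>reps s. indicat_real (fiber s z) y *\<^sub>R h z)
      = (\<Sum>z\<in>reps s. if z = z0 then h z0 else 0)"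
    by (intro sum.cong) (auto simp: indicator_def fib)
  also have "\<dots> = h z0"
    using finite_reps z0 by simp
  also have "\<dots> = h y"
    using h y reps_space[OF z0] unfolding cyl_def by (metis z0_def)
  finally show ?thesis by simp
qed

lemma
  fixes c :: "'b::{banach,second_countable_topology}"
  assumes "z \<in> space \<mu>"
  shows integrable_fiber: "integrable \<mu> (\<lambda>y. indicat_real (fiber s z) y *\<^sub>R c)"
    and integral_fiber: "(LINT y|\<mu>. indicat_real (fiber s z) y *\<^sub>R c) = (1 / M s) *\<^sub>R c"
proof -
  have int: "integrable \<mu> (indicat_real (fiber s z))"
    by (intro integrable_real_indicator sets_fiber assms) (simp add: less_top[symmetric])
  show "integrable \<mu> (\<lambda>y. indicat_real (fiber s z) y *\<^sub>R c)"
    using int by (rule integrable_scaleR_left)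
  show "(LINT y|\<mu>. indicat_real (fiber s z) y *\<^sub>R c) = (1 / M s) *\<^sub>R c"
    by (subst integral_scaleR_left[OF int])
      (simp add: measure_fiber[OF assms] sets_fiber[OF assms])
qed

text \<open>Termwise integration of \<open>cyl_representation\<close>. Measurability and
  integrability of kernels are obtained from here by exhibiting them as cylinder functions.\<close>

lemma
  fixes h :: "(nat \<Rightarrow> nat) \<Rightarrow> 'b::{banach,second_countable_topology}"
  assumes h: "cyl s h"
  shows integrable_cyl: "integrable \<mu> h"
    and integral_cyl: "integral\<^sup>L \<mu> h = (\<Sum>z\<in>reps s. (1 / M s) *\<^sub>R h z)"
proof -
  have int: "integrable \<mu> (\<lambda>y. indicat_real (fiber s z) y *\<^sub>R h z)" if "z \<in> reps s" for z
    by (rule integrable_fiber[OF reps_space[OF that]])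
  have "integrable \<mu> (\<lambda>y. \<Sum>z\<in>reps s. indicat_real (fiber s z) y *\<^sub>R h z)"
    using int by (rule Bochner_Integration.integrable_sum)
  then show "integrable \<mu> h"
    by (subst Bochner_Integration.integrable_cong[OF refl cyl_representation[OF h]]) auto
  have "integral\<^sup>L \<mu> h = (LINT y|\<mu>. (\<Sum>z\<in>reps s. indicat_real (fiber s z) y *\<^sub>R h z))"
    by (rule Bochner_Integration.integral_cong[OF refl cyl_representation[OF h]])
  also have "\<dots> = (\<Sum>z\<in>reps s. (LINT y|\<mu>. indicat_real (fiber s z) y *\<^sub>R h z))"
    using int by (rule Bochner_Integration.integral_sum)
  also have "\<dots> = (\<Sum>z\<in>reps s. (1 / M s) *\<^sub>R h z)"
    by (intro sum.cong refl integral_fiber reps_space)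
  finally show "integral\<^sup>L \<mu> h = (\<Sum>z\<in>reps s. (1 / M s) *\<^sub>R h z)" .
qed

lemma measurable_cyl:
  fixes h :: "(nat \<Rightarrow> nat) \<Rightarrow> 'b::{banach,second_countable_topology}"
  shows "cyl s h \<Longrightarrow> h \<in> borel_measurable \<mu>"
  by (rule borel_measurable_integrable[OF integrable_cyl])

text \<open>Coordinate \<open>s\<close> is independent of the coordinates below \<open>s\<close>.\<close>

lemma integral_cyl_coord:
  fixes h :: "(nat \<Rightarrow> nat) \<Rightarrow> 'b::{banach,second_countable_topology}"
  assumes h: "cyl s h" and c: "c < m s"
  shows "(LINT y|\<mu>. (if y s = c then real (m s) else 0) *\<^sub>R h y) = integral\<^sup>L \<mu> h"
proof -
  \<comment> \<open>The points of \<open>fiber s z\<close> with coordinate \<open>s\<close> equal to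
    \<open>c\<close> form a fiber of rank \<open>s + 1\<close>, smaller in measure by exactly the
    factor \<open>m s\<close>.\<close>
  define G where "G z = fiber (Suc s) (z(s := c))" for z
  have sp: "z(s := c) \<in> space \<mu>" if "z \<in> reps s" for z
    using reps_space[OF that] c by (auto simp: space_vilenkin)
  have ind: "(if y s = c then real (m s) else 0) * indicat_real (fiber s z) y
      = real (m s) * indicat_real (G z) y" if "y \<in> space \<mu>" for y z
    using that by (auto simp: indicator_def fiber_def G_def less_Suc_eq)
  have "(LINT y|\<mu>. (if y s = c then real (m s) else 0) *\<^sub>R h y)
      = (LINT y|\<mu>. (\<Sum>z\<in>reps s. indicat_real (G z) y *\<^sub>R (real (m s) *\<^sub>R h z)))"
  proof (rule Bochner_Integration.integral_cong[OF refl])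
    fix y assume y: "y \<in> space \<mu>"
    have "(if y s = c then real (m s) else 0) *\<^sub>R h y
       = (\<Sum>z\<in>reps s. ((if y s = c then real (m s) else 0) * indicat_real (fiber s z) y) *\<^sub>R h z)"
      unfolding cyl_representation[OF h y] by (simp only: scaleR_sum_right scaleR_scaleR)
    also have "\<dots> = (\<Sum>z\<in>reps s. indicat_real (G z) y *\<^sub>R (real (m s) *\<^sub>R h z))"
      by (simp only: ind[OF y] scaleR_scaleR) (simp only: mult.commute)
    finally show "(if y s = c then real (m s) else 0) *\<^sub>R h y = \<dots>" .
  qed
  also have "\<dots> = (\<Sum>z\<in>reps s. (LINT y|\<mu>. indicat_real (G z) y *\<^sub>R (real (m s) *\<^sub>R h z)))"
    unfolding G_def by (intro Bochner_Integration.integral_sum integrable_fiber sp)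
  also have "\<dots> = (\<Sum>z\<in>reps s. (1 / M s) *\<^sub>R h z)"
    using m_pos[of s]
    by (intro sum.cong refl, unfold G_def, subst integral_fiber[OF sp]) auto
  finally show ?thesis
    by (simp add: integral_cyl[OF h])
qed

subsection \<open>Dirichlet and Fejer kernels\<close>

definition dirichlet :: "nat \<Rightarrow> (nat \<Rightarrow> nat) \<Rightarrow> (nat \<Rightarrow> nat) \<Rightarrow> complex" where
  "dirichlet n x y = (\<Sum>k<n. \<psi> k x * cnj (\<psi> k y))"

text \<open>Unnormalised and shifted by one: since \<open>dirichlet 0\<close> vanishes,
  \<open>fejer (Suc n)\<close> is \<open>n\<close> times the usual Fejer kernel of order
  \<open>n\<close>.\<close>

definition fejer :: "nat \<Rightarrow> (nat \<Rightarrow> nat) \<Rightarrow> (nat \<Rightarrow> nat) \<Rightarrow> complex" where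
  "fejer n x y = (\<Sum>j<n. dirichlet j x y)"

definition \<omega> :: "nat \<Rightarrow> (nat \<Rightarrow> nat) \<Rightarrow> (nat \<Rightarrow> nat) \<Rightarrow> complex" where
  "\<omega> s x y = \<rho> s x * cnj (\<rho> s y)"

lemma dirichlet_0 [simp]: "dirichlet 0 x y = 0"
  by (simp add: dirichlet_def)

text \<open>The frequencies from \<open>b * M s\<close> up to \<open>b * M s + r\<close> are those
  below \<open>r\<close> multiplied by a power of a single Rademacher function.\<close>

lemma dirichlet_add:
  assumes "r \<le> M s" "b < m s"
  shows "dirichlet (b * M s + r) x y = dirichlet (b * M s) x y + \<omega> s x y ^ b * dirichlet r x y"
proof -
  have "dirichlet (b * M s + r) x y = dirichlet (b * M s) x y
      + (\<Sum>i<r. \<psi> (b * M s + i) x * cnj (\<psi> (b * M s + i) y))"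
    by (simp add: dirichlet_def sum_lessThan_add)
  also have "(\<Sum>i<r. \<psi> (b * M s + i) x * cnj (\<psi> (b * M s + i) y))
      = (\<Sum>i<r. \<omega> s x y ^ b * (\<psi> i x * cnj (\<psi> i y)))"
    using assms by (intro sum.cong refl)
      (simp add: vilenkin_fun_add \<omega>_def power_mult_distrib mult_ac)
  finally show ?thesis by (simp add: dirichlet_def sum_distrib_left)
qed

lemma dirichlet_mult:
  "b \<le> m s \<Longrightarrow> dirichlet (b * M s) x y = (\<Sum>a<b. \<omega> s x y ^ a) * dirichlet (M s) x y"
proof (induction b)
  case (Suc b)
  then have "dirichlet (b * M s + M s) x y = (\<Sum>a<Suc b. \<omega> s x y ^ a) * dirichlet (M s) x y"
    by (subst dirichlet_add) (auto simp: algebra_simps)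
  then show ?case by (simp add: add.commute)
qed simp

lemma fejer_add:
  assumes "r \<le> M s" "b < m s"
  shows "fejer (b * M s + r) x y
    = fejer (b * M s) x y + of_nat r * dirichlet (b * M s) x y + \<omega> s x y ^ b * fejer r x y"
proof -
  have "fejer (b * M s + r) x y = fejer (b * M s) x y + (\<Sum>i<r. dirichlet (b * M s + i) x y)"
    by (simp add: fejer_def sum_lessThan_add)
  also have "(\<Sum>i<r. dirichlet (b * M s + i) x y)
      = (\<Sum>i<r. dirichlet (b * M s) x y + \<omega> s x y ^ b * dirichlet i x y)"
    using assms by (intro sum.cong refl dirichlet_add) auto
  finally show ?thesis by (simp add: fejer_def sum.distrib sum_distrib_left)
qed

text \<open>Iteration of \<open>fejer_add\<close> over full blocks. At \<open>b = m s\<close> the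
  factor of \<open>fejer (M s)\<close> collapses by \<open>sum_\<omega>\<close>.\<close>

lemma fejer_mult:
  "b \<le> m s \<Longrightarrow> fejer (b * M s) x y = (\<Sum>a<b. of_nat (M s) * dirichlet (a * M s) x y)
     + (\<Sum>a<b. \<omega> s x y ^ a) * fejer (M s) x y"
proof (induction b)
  case 0
  then show ?case by (simp add: fejer_def)
next
  case (Suc b)
  then have "fejer (b * M s + M s) x y = (\<Sum>a<Suc b. of_nat (M s) * dirichlet (a * M s) x y)
     + (\<Sum>a<Suc b. \<omega> s x y ^ a) * fejer (M s) x y"
    by (subst fejer_add) (auto simp: algebra_simps)
  then show ?case by (simp add: add.commute)
qed

section \<open>Roots of unity and the Dirichlet kernels of order \<open>M s\<close>\<close>

lemma norm_\<omega> [simp]: "norm (\<omega> s x y) = 1"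
  by (simp add: \<omega>_def rademacher_def norm_mult)

text \<open>A geometric sum: \<open>\<omega> s x y\<close> is an \<open>m s\<close>-th root of
  unity, equal to 1 exactly when the coordinates \<open>s\<close> agree.\<close>

lemma sum_\<omega>:
  assumes "x \<in> space \<mu>" "y \<in> space \<mu>"
  shows "(\<Sum>a<m s. \<omega> s x y ^ a) = (if y s = x s then of_nat (m s) else 0)"
proof -
  have x: "x s < m s" and y: "y s < m s" using assms by (auto simp: space_vilenkin)
  have m: "m s > 0" by (rule m_pos)
  have \<omega>: "\<omega> s x y = exp (2 * of_real pi * \<i> * (of_nat (x s) - of_nat (y s)) / of_nat (m s))"
    by (simp add: \<omega>_def rademacher_def exp_cnj exp_add[symmetric] diff_divide_distrib
        right_diff_distrib)
  show ?thesis
  proof (cases "y s = x s")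
    case True
    then show ?thesis by (simp add: \<omega>)
  next
    case False
    have "\<omega> s x y ^ m s = exp (of_nat (m s) * (2 * of_real pi * \<i> * (of_nat (x s) - of_nat (y s)) / of_nat (m s)))"
      by (simp only: \<omega> exp_of_nat_mult)
    also have "of_nat (m s) * (2 * of_real pi * \<i> * (of_nat (x s) - of_nat (y s)) / of_nat (m s))
       = 2 * of_real pi * \<i> * of_int (int (x s) - int (y s))"
      using m by simp
    also have "exp (2 * of_real pi * \<i> * of_int (int (x s) - int (y s))) = 1"
      unfolding exp_eq_1 by (auto intro!: exI[of _ "int (x s) - int (y s)"])
    finally have 1: "\<omega> s x y ^ m s = 1" .
    have "\<omega> s x y \<noteq> 1"
    proof
      assume "\<omega> s x y = 1"
      then obtain k :: int where k: "2 * pi * (real (x s) - real (y s)) / real (m s) = 2 * pi * of_int k"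
        unfolding \<omega> exp_eq_1 by (auto simp: Im_divide_of_nat)
      then have "2 * pi * (real (x s) - real (y s)) = 2 * pi * (of_int k * real (m s))"
        using m by (simp add: divide_eq_eq)
      then have "real (x s) - real (y s) = of_int k * real (m s)"
        by (simp only: mult_cancel_left) simp
      then have "real_of_int (int (x s) - int (y s)) = real_of_int (k * int (m s))"
        by simp
      then have "int (x s) - int (y s) = k * int (m s)"
        by (simp only: of_int_eq_iff)
      \<comment> \<open>Two residues differ by less than the modulus, so the only possible multiple
        is zero.\<close>
      moreover have "\<bar>int (x s) - int (y s)\<bar> < int (m s)" using x y by linarith
      ultimately have "k = 0"
        by (metis abs_mult abs_of_nat mult_less_cancel_right2 abs_ge_zero of_nat_less_0_iff
            zero_less_abs_iff int_one_le_iff_zero_less not_less)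
      then show False
        using \<open>int (x s) - int (y s) = k * int (m s)\<close> False by simp
    qed
    then show ?thesis
      using False 1 geometric_sum[of "\<omega> s x y" "m s"] by simp
  qed
qed

text \<open>Iterated, this is the classical closed form: \<open>dirichlet (M s) x\<close> is
  \<open>M s\<close> on the fiber of rank \<open>s\<close> around \<open>x\<close> and 0
  elsewhere.\<close>

lemma dirichlet_M_Suc:
  assumes "x \<in> space \<mu>" "y \<in> space \<mu>"
  shows "dirichlet (M (Suc s)) x y = (if y s = x s then real (m s) else 0) *\<^sub>R dirichlet (M s) x y"
  using dirichlet_mult[of "m s" s x y] by (simp add: sum_\<omega>[OF assms] scaleR_conv_of_real)

lemma cyl_dirichlet: "n \<le> M s \<Longrightarrow> cyl s (dirichlet n x)"
  unfolding dirichlet_def[abs_def]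
  by (intro cyl_sum cyl_comp[where F = "\<lambda>v. \<psi> k x * cnj v" for k] cyl_vilenkin_fun) auto

text \<open>The index \<open>M s + 1\<close> is still allowed because \<open>fejer n\<close>
  involves only Dirichlet kernels of order below \<open>n\<close>.\<close>

lemma cyl_fejer: "n \<le> Suc (M s) \<Longrightarrow> cyl s (fejer n x)"
  unfolding fejer_def[abs_def] by (intro cyl_sum cyl_dirichlet) auto

lemma integrable_dirichlet: "integrable \<mu> (dirichlet n x)"
  by (rule integrable_cyl[OF cyl_dirichlet[of n n]])
    (rule less_imp_le[OF M_gt])

lemma integrable_fejer: "integrable \<mu> (fejer n x)"
  unfolding fejer_def[abs_def] by (intro Bochner_Integration.integrable_sum integrable_dirichlet)

text \<open>Each step from \<open>s\<close> to \<open>s + 1\<close> multiplies the kernel by a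
  nonnegative factor of mean 1 that is independent of the earlier coordinates.\<close>

lemma
  assumes x: "x \<in> space \<mu>"
  shows integral_dirichlet_M: "(LINT y|\<mu>. dirichlet (M s) x y) = 1"
    and L1_dirichlet_M: "(LINT y|\<mu>. norm (dirichlet (M s) x y)) = 1"
proof (induction s)
  case 0
  show "(LINT y|\<mu>. dirichlet (M 0) x y) = 1" "(LINT y|\<mu>. norm (dirichlet (M 0) x y)) = 1"
    by (simp_all add: dirichlet_def vilenkin_fun_eq_prod[OF m_ge2] prob_space)
next
  case (Suc s)
  have xs: "x s < m s" using x by (auto simp: space_vilenkin)
  have "(LINT y|\<mu>. dirichlet (M (Suc s)) x y)
      = (LINT y|\<mu>. (if y s = x s then real (m s) else 0) *\<^sub>R dirichlet (M s) x y)"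
    by (intro Bochner_Integration.integral_cong refl dirichlet_M_Suc x)
  also have "\<dots> = (LINT y|\<mu>. dirichlet (M s) x y)"
    by (intro integral_cyl_coord cyl_dirichlet xs) auto
  finally show "(LINT y|\<mu>. dirichlet (M (Suc s)) x y) = 1" using Suc by simp
  have "(LINT y|\<mu>. norm (dirichlet (M (Suc s)) x y))
      = (LINT y|\<mu>. (if y s = x s then real (m s) else 0) *\<^sub>R norm (dirichlet (M s) x y))"
    by (intro Bochner_Integration.integral_cong refl) (simp add: dirichlet_M_Suc[OF x] del: vilenkin_M.simps)
  also have "\<dots> = (LINT y|\<mu>. norm (dirichlet (M s) x y))"
    by (intro integral_cyl_coord cyl_comp[OF cyl_dirichlet] xs) auto
  finally show "(LINT y|\<mu>. norm (dirichlet (M (Suc s)) x y)) = 1" using Suc by simp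
qed

lemma dirichlet_M_eq_0:
  assumes "x \<in> space \<mu>" "y \<in> space \<mu>" "i < s" "y i \<noteq> x i"
  shows "dirichlet (M s) x y = 0"
  using assms(3)
  by (induction s) (auto simp: dirichlet_M_Suc[OF assms(1,2)] assms(4) less_Suc_eq simp del: vilenkin_M.simps)

end

text \<open>Abel summation with boundary weight \<open>q n\<close>, one past the last weight on the
  left; for nonnegative decreasing \<open>q\<close> every weight on the right is
  nonnegative.\<close>

lemma sum_by_parts:
  fixes q :: "nat \<Rightarrow> real" and a :: "nat \<Rightarrow> 'a::real_vector"
  shows "(\<Sum>j<n. q j *\<^sub>R a j)
    = q n *\<^sub>R (\<Sum>j<n. a j) + (\<Sum>k<n. (q k - q (Suc k)) *\<^sub>R (\<Sum>j<Suc k. a j))"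
  by (induction n) (simp_all add: algebra_simps)

context vilenkin
begin

section \<open>Uniform L1 bounds for the kernels\<close>

abbreviation L1 :: "((nat \<Rightarrow> nat) \<Rightarrow> complex) \<Rightarrow> real" where
  "L1 K \<equiv> LINT y|\<mu>. norm (K y)"

lemma L1_add:
  assumes "integrable \<mu> f" "integrable \<mu> g"
  shows "L1 (\<lambda>y. f y + g y) \<le> L1 f + L1 g"
proof -
  have "L1 (\<lambda>y. f y + g y) \<le> (LINT y|\<mu>. norm (f y) + norm (g y))"
    using assms by (intro integral_mono norm_triangle_ineq) auto
  also have "\<dots> = L1 f + L1 g"
    using assms by (intro Bochner_Integration.integral_add) auto
  finally show ?thesis .
qed

lemma L1_sum:
  assumes "\<And>i. i \<in> I \<Longrightarrow> integrable \<mu> (f i)"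
  shows "L1 (\<lambda>y. \<Sum>i\<in>I. f i y) \<le> (\<Sum>i\<in>I. L1 (f i))"
proof -
  have "L1 (\<lambda>y. \<Sum>i\<in>I. f i y) \<le> (LINT y|\<mu>. (\<Sum>i\<in>I. norm (f i y)))"
    using assms by (intro integral_mono norm_sum integrable_norm Bochner_Integration.integrable_sum) auto
  also have "\<dots> = (\<Sum>i\<in>I. L1 (f i))"
    using assms by (intro Bochner_Integration.integral_sum) auto
  finally show ?thesis .
qed

lemma integrable_omega_dirichlet: "integrable \<mu> (\<lambda>y. \<omega> s x y ^ a * dirichlet n x y)"
  and integrable_omega_fejer: "integrable \<mu> (\<lambda>y. \<omega> s x y ^ a * fejer n x y)"
proof -
  \<comment> \<open>The rank \<open>s + n + 1\<close> covers both the coordinate \<open>s\<close>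
    used by \<open>\<omega> s\<close> and, since \<open>n < M n\<close>, the kernels of order
    \<open>n\<close>.\<close>
  have s: "Suc s \<le> Suc (s + n)" and n: "n \<le> M (Suc (s + n))"
    using M_gt[of n] M_mono[of n "Suc (s + n)"] by (simp_all del: vilenkin_M.simps)
  have "cyl (Suc s) (\<omega> s x)"
    unfolding \<omega>_def[abs_def] rademacher_def
    by (rule cyl_coord[where F = "\<lambda>v. _ * cnj (exp (2 * of_real pi * \<i> * of_nat v / of_nat (m s)))"]) simp
  then have "cyl (Suc (s + n)) (\<omega> s x)" using s by (rule cyl_mono)
  moreover have "cyl (Suc (s + n)) (dirichlet n x)" "cyl (Suc (s + n)) (fejer n x)"
    using n by (auto intro!: cyl_dirichlet cyl_fejer simp del: vilenkin_M.simps)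
  ultimately show "integrable \<mu> (\<lambda>y. \<omega> s x y ^ a * dirichlet n x y)"
    "integrable \<mu> (\<lambda>y. \<omega> s x y ^ a * fejer n x y)"
    by (auto intro!: integrable_cyl cyl_comp2[where F = "\<lambda>u v. u ^ a * v"])
qed

text \<open>The kernel is a sum of \<open>b\<close> unimodular multiples of
  \<open>dirichlet (M s) x\<close>, each of L1 norm 1.\<close>

lemma L1_dirichlet_mult:
  assumes x: "x \<in> space \<mu>" and b: "b \<le> m s"
  shows "L1 (dirichlet (b * M s) x) \<le> b"
proof -
  have "dirichlet (b * M s) x y = (\<Sum>a<b. \<omega> s x y ^ a * dirichlet (M s) x y)" for y
    using dirichlet_mult[OF b] by (simp add: sum_distrib_right)
  then have "L1 (dirichlet (b * M s) x) = L1 (\<lambda>y. \<Sum>a<b. \<omega> s x y ^ a * dirichlet (M s) x y)"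
    by simp
  also have "\<dots> \<le> (\<Sum>a<b. L1 (\<lambda>y. \<omega> s x y ^ a * dirichlet (M s) x y))"
    by (intro L1_sum integrable_omega_dirichlet)
  also have "\<dots> = b"
    by (simp add: norm_mult norm_power L1_dirichlet_M[OF x])
  finally show ?thesis .
qed

text \<open>Here boundedness of \<open>m\<close> enters: each of the \<open>b\<close> kernels has
  norm at most \<open>a < b\<close>, hence at most \<open>B\<close>.\<close>

lemma L1_dirichlet_sum:
  assumes x: "x \<in> space \<mu>" and b: "b \<le> m s" and B: "m s \<le> B"
  shows "L1 (\<lambda>y. \<Sum>a<b. of_nat (M s) * dirichlet (a * M s) x y) \<le> real (b * M s) * B"
proof -
  have "L1 (\<lambda>y. \<Sum>a<b. of_nat (M s) * dirichlet (a * M s) x y)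
      \<le> (\<Sum>a<b. L1 (\<lambda>y. of_nat (M s) * dirichlet (a * M s) x y))"
    by (intro L1_sum integrable_mult_right integrable_dirichlet)
  also have "\<dots> = (\<Sum>a<b. real (M s) * L1 (dirichlet (a * M s) x))"
    by (simp add: norm_mult)
  also have "\<dots> \<le> (\<Sum>a<b. real (M s) * B)"
  proof (intro sum_mono mult_left_mono)
    fix a assume a: "a \<in> {..<b}"
    have "L1 (dirichlet (a * M s) x) \<le> a"
      using a b by (intro L1_dirichlet_mult x) auto
    also have "\<dots> \<le> B" using a b B by simp
    finally show "L1 (dirichlet (a * M s) x) \<le> B" .
  qed auto
  finally show ?thesis by simp
qed

text \<open>Collapsing the powers of \<open>\<omega>\<close> before taking norms is essential. The
  triangle inequality would multiply the previous bound by \<open>m s\<close>, and the ratio to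
  \<open>M s\<close> would grow by \<open>B\<close> at each level.\<close>

lemma L1_fejer_M:
  assumes x: "x \<in> space \<mu>" and B: "\<And>k. m k \<le> B"
  shows "L1 (fejer (M s) x) \<le> 2 * real B * real (M s)"
proof (induction s)
  case 0
  then show ?case by (simp add: fejer_def)
next
  case (Suc s)
  have xs: "x s < m s" using x by (auto simp: space_vilenkin)
  have "L1 (fejer (M (Suc s)) x) = L1 (\<lambda>y. (\<Sum>a<m s. of_nat (M s) * dirichlet (a * M s) x y)
      + (if y s = x s then real (m s) else 0) *\<^sub>R fejer (M s) x y)"
    by (intro Bochner_Integration.integral_cong refl arg_cong[where f = norm])
      (simp add: fejer_mult[OF order_refl] sum_\<omega>[OF x] scaleR_conv_of_real)
  also have "\<dots> \<le> L1 (\<lambda>y. \<Sum>a<m s. of_nat (M s) * dirichlet (a * M s) x y)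
      + L1 (\<lambda>y. (if y s = x s then real (m s) else 0) *\<^sub>R fejer (M s) x y)"
  proof (rule L1_add)
    show "integrable \<mu> (\<lambda>y. \<Sum>a<m s. of_nat (M s) * dirichlet (a * M s) x y)"
      by (intro Bochner_Integration.integrable_sum integrable_mult_right integrable_dirichlet)
    show "integrable \<mu> (\<lambda>y. (if y s = x s then real (m s) else 0) *\<^sub>R fejer (M s) x y)"
      by (intro integrable_cyl[of "Suc s"] cyl_comp2[where F = "(*\<^sub>R)"]
          cyl_coord[where F = "\<lambda>v. if v = x s then real (m s) else 0"]
          cyl_mono[OF cyl_fejer, of _ s]) auto
  qed
  also have "L1 (\<lambda>y. (if y s = x s then real (m s) else 0) *\<^sub>R fejer (M s) x y)
      = (LINT y|\<mu>. (if y s = x s then real (m s) else 0) *\<^sub>R norm (fejer (M s) x y))"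
    by (intro Bochner_Integration.integral_cong refl) simp
  also have "\<dots> = L1 (fejer (M s) x)"
    by (intro integral_cyl_coord cyl_comp[OF cyl_fejer] xs) auto
  also have "\<dots> \<le> 2 * real B * real (M s)" by (rule Suc)
  also have "L1 (\<lambda>y. \<Sum>a<m s. of_nat (M s) * dirichlet (a * M s) x y) \<le> real (m s * M s) * B"
    by (intro L1_dirichlet_sum x order_refl B)
  \<comment> \<open>As \<open>m s \<ge> 2\<close>, the part carried over from level \<open>s\<close>
    is at most the bound for the new part, so the constant \<open>2 * B\<close> reproduces
    itself.\<close>
  also have "2 * real B * real (M s) = real (2 * M s) * B" by simp
  also have "\<dots> \<le> real (m s * M s) * B"
    using m_ge2[of s] by (intro mult_right_mono of_nat_mono mult_le_mono1) auto
  finally show ?case by (simp add: algebra_simps)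
qed

text \<open>Induction on the number of digits, splitting off the leading digit \<open>a\<close>. Per
  unit of \<open>a * M s\<close> the Dirichlet sum costs \<open>B\<close>, the copies of
  \<open>fejer (M s)\<close> cost \<open>2 * B\<close>, and the term with factor
  \<open>r < M s\<close> costs 1; the remainder \<open>r\<close> has the same constant by
  induction.\<close>

lemma L1_fejer:
  assumes x: "x \<in> space \<mu>" and B: "\<And>k. m k \<le> B"
  shows "L1 (fejer n x) \<le> (3 * real B + 1) * n"
proof -
  have "n < M s \<Longrightarrow> L1 (fejer n x) \<le> (3 * real B + 1) * n" for s
  proof (induction s arbitrary: n)
    case 0
    then show ?case by (simp add: fejer_def)
  next
    case (Suc s)
    define a r where "a = n div M s" and "r = n mod M s"
    have r: "r < M s" using M_pos by (simp add: r_def)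
    have n: "n = a * M s + r" unfolding a_def r_def by (rule div_mult_mod_eq[symmetric])
    have a: "a < m s"
      using Suc.prems by (simp add: a_def div_less_iff_less_mult[OF M_pos])
    have "fejer n x y = ((\<Sum>b<a. of_nat (M s) * dirichlet (b * M s) x y)
        + (\<Sum>b<a. \<omega> s x y ^ b * fejer (M s) x y))
        + (of_nat r * dirichlet (a * M s) x y + \<omega> s x y ^ a * fejer r x y)" for y
      unfolding n using a r by (simp add: fejer_add fejer_mult sum_distrib_right)
    then have "L1 (fejer n x) \<le> (L1 (\<lambda>y. \<Sum>b<a. of_nat (M s) * dirichlet (b * M s) x y)
        + L1 (\<lambda>y. \<Sum>b<a. \<omega> s x y ^ b * fejer (M s) x y))
        + (L1 (\<lambda>y. of_nat r * dirichlet (a * M s) x y) + L1 (\<lambda>y. \<omega> s x y ^ a * fejer r x y))"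
      by (simp only:) (intro order_trans[OF L1_add] add_mono L1_add
        Bochner_Integration.integrable_add Bochner_Integration.integrable_sum integrable_mult_right
        integrable_dirichlet integrable_omega_fejer)
    moreover have "L1 (\<lambda>y. \<Sum>b<a. of_nat (M s) * dirichlet (b * M s) x y) \<le> real (a * M s) * B"
      using a by (intro L1_dirichlet_sum x B) auto
    moreover have "L1 (\<lambda>y. \<Sum>b<a. \<omega> s x y ^ b * fejer (M s) x y)
        \<le> (\<Sum>b<a. L1 (\<lambda>y. \<omega> s x y ^ b * fejer (M s) x y))"
      by (intro L1_sum integrable_omega_fejer)
    moreover have "(\<Sum>b<a. L1 (\<lambda>y. \<omega> s x y ^ b * fejer (M s) x y)) \<le> real a * (2 * real B * real (M s))"
      using L1_fejer_M[OF x B, of s] by (simp add: norm_mult norm_power mult_left_mono)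
    moreover have "L1 (\<lambda>y. of_nat r * dirichlet (a * M s) x y) \<le> real r * real a"
      using L1_dirichlet_mult[OF x, of a s] a by (auto simp: norm_mult intro!: mult_left_mono)
    moreover have "real r * real a \<le> real (a * M s)"
      using r by (simp add: mult.commute mult_left_mono)
    moreover have "L1 (\<lambda>y. \<omega> s x y ^ a * fejer r x y) \<le> (3 * real B + 1) * r"
      using Suc.IH[OF r] by (simp add: norm_mult norm_power)
    ultimately have "L1 (fejer n x) \<le> real (a * M s) * B + real a * (2 * real B * real (M s))
        + (real (a * M s) + (3 * real B + 1) * r)"
      by linarith
    also have "\<dots> = (3 * real B + 1) * n"
      unfolding n by (simp add: algebra_simps)
    finally show ?case .
  qed
  then show ?thesis using M_gt by blast
qed

text \<open>After \<open>sum_by_parts\<close> all weights are nonnegative, so the linear bounds of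
  \<open>L1_fejer\<close> can be added with these weights.\<close>

lemma L1_weighted_dirichlet:
  assumes x: "x \<in> space \<mu>" and B: "\<And>k. m k \<le> B" and q: "\<And>k. q k \<ge> 0" "decseq q"
  shows "L1 (\<lambda>y. \<Sum>j<n. q j *\<^sub>R dirichlet j x y) \<le> (3 * real B + 1) * (\<Sum>j<n. q j)"
proof -
  have d: "q k - q (Suc k) \<ge> 0" for k using q(2) by (simp add: decseq_Suc_iff)
  have "(\<Sum>j<n. q j *\<^sub>R dirichlet j x y)
      = q n *\<^sub>R fejer n x y + (\<Sum>k<n. (q k - q (Suc k)) *\<^sub>R fejer (Suc k) x y)" for y
    unfolding fejer_def by (rule sum_by_parts)
  then have "L1 (\<lambda>y. \<Sum>j<n. q j *\<^sub>R dirichlet j x y)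
      \<le> L1 (\<lambda>y. q n *\<^sub>R fejer n x y) + L1 (\<lambda>y. \<Sum>k<n. (q k - q (Suc k)) *\<^sub>R fejer (Suc k) x y)"
    by (simp only:) (intro L1_add Bochner_Integration.integrable_sum integrable_scaleR_right
      integrable_fejer)
  also have "\<dots> \<le> L1 (\<lambda>y. q n *\<^sub>R fejer n x y)
      + (\<Sum>k<n. L1 (\<lambda>y. (q k - q (Suc k)) *\<^sub>R fejer (Suc k) x y))"
    by (intro add_left_mono L1_sum integrable_scaleR_right integrable_fejer)
  also have "\<dots> = q n * L1 (fejer n x) + (\<Sum>k<n. (q k - q (Suc k)) * L1 (fejer (Suc k) x))"
    using q(1) d by simp
  also have "\<dots> \<le> q n * ((3 * real B + 1) * n)
      + (\<Sum>k<n. (q k - q (Suc k)) * ((3 * real B + 1) * Suc k))"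
    by (intro add_mono sum_mono mult_left_mono L1_fejer x B q(1) d)
  also have "\<dots> = (3 * real B + 1) * (q n * n + (\<Sum>k<n. (q k - q (Suc k)) * Suc k))"
    unfolding distrib_left sum_distrib_left by (simp only: mult.left_commute)
  \<comment> \<open>Summation by parts read backwards, for the constant sequence 1.\<close>
  also have "q n * n + (\<Sum>k<n. (q k - q (Suc k)) * Suc k) = (\<Sum>j<n. q j)"
    using sum_by_parts[of q "\<lambda>_. 1 :: real" n] by simp
  finally show ?thesis .
qed

text \<open>The last \<open>j\<close> terms of \<open>dirichlet (M s)\<close> are the reflections of
  the first \<open>j\<close>.\<close>

lemma dirichlet_reflect:
  "j \<le> M s \<Longrightarrow> dirichlet (M s - j) x y
    = dirichlet (M s) x y - \<psi> (M s - 1) x * cnj (\<psi> (M s - 1) y) * cnj (dirichlet j x y)"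
proof (induction j)
  case (Suc j)
  have "M s - j = Suc (M s - 1 - j)" and i: "j < M s" using Suc.prems by auto
  then have "dirichlet (M s - Suc j) x y
      = dirichlet (M s - j) x y - \<psi> (M s - 1 - j) x * cnj (\<psi> (M s - 1 - j) y)"
    by (simp add: dirichlet_def)
  also have "\<psi> (M s - 1 - j) x * cnj (\<psi> (M s - 1 - j) y)
      = \<psi> (M s - 1) x * cnj (\<psi> (M s - 1) y) * cnj (\<psi> j x * cnj (\<psi> j y))"
    unfolding vilenkin_fun_reflect'[OF i] by (simp add: mult_ac)
  finally have "dirichlet (M s - Suc j) x y = dirichlet (M s) x y
      - \<psi> (M s - 1) x * cnj (\<psi> (M s - 1) y) * cnj (dirichlet j x y)
      - \<psi> (M s - 1) x * cnj (\<psi> (M s - 1) y) * cnj (\<psi> j x * cnj (\<psi> j y))"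
    using Suc.IH i by (simp only: less_imp_le)
  then show ?case
    by (simp only: diff_diff_eq distrib_left[symmetric] complex_cnj_add[symmetric])
      (simp add: dirichlet_def)
qed simp

subsection \<open>Kernels of the means\<close>

definition norlund_kernel :: "(nat \<Rightarrow> real) \<Rightarrow> nat \<Rightarrow> (nat \<Rightarrow> nat) \<Rightarrow> (nat \<Rightarrow> nat) \<Rightarrow> complex" where
  "norlund_kernel q n x y
    = 1 / of_real (\<Sum>k<n. q k) * (\<Sum>k=1..n. of_real (q (n - k)) * dirichlet k x y)"

text \<open>The weights \<open>q (n - k)\<close> increase with \<open>k\<close>, the wrong direction
  for summation by parts. Reflection at \<open>n = M s\<close> attaches \<open>q j\<close> to
  \<open>dirichlet j\<close> instead. The bound is 1 from \<open>dirichlet n\<close> plus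
  \<open>3 * B + 1\<close> from the weighted sum.\<close>

lemma L1_norlund_kernel:
  assumes x: "x \<in> space \<mu>" and B: "\<And>k. m k \<le> B"
    and q: "\<And>k. q k \<ge> 0" "decseq q" "q 0 > 0"
  shows "L1 (norlund_kernel q (M s) x) \<le> 3 * real B + 2"
proof -
  define n where "n = M s"
  define Q where "Q = (\<Sum>k<n. q k)"
  have Q: "Q > 0"
    unfolding Q_def n_def using q M_pos[of s] by (intro sum_pos2[of _ 0]) auto
  define u where "u y = \<psi> (n - 1) x * cnj (\<psi> (n - 1) y)" for y
  have u: "norm (u y) = 1" for y
    by (simp add: u_def norm_mult norm_vilenkin_fun[OF m_ge2])
  define S where "S y = (\<Sum>j<n. q j *\<^sub>R dirichlet j x y)" for y
  have "(\<Sum>k=1..n. of_real (q (n - k)) * dirichlet k x y) = of_real Q * dirichlet n x y - u y * cnj (S y)"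
    for y
  proof -
    have "(\<Sum>k=1..n. of_real (q (n - k)) * dirichlet k x y)
        = (\<Sum>j<n. of_real (q j) * dirichlet (n - j) x y)"
      by (rule sum.reindex_bij_witness[of _ "\<lambda>j. n - j" "\<lambda>k. n - k"]) auto
    also have "\<dots> = (\<Sum>j<n. of_real (q j) * dirichlet n x y - u y * cnj (q j *\<^sub>R dirichlet j x y))"
      by (intro sum.cong refl)
        (simp add: n_def dirichlet_reflect u_def scaleR_conv_of_real algebra_simps)
    finally show ?thesis
      by (simp add: Q_def S_def sum_subtractf sum_distrib_left sum_distrib_right)
  qed
  then have K: "norlund_kernel q n x y
      = dirichlet n x y + (- (u y * cnj (S y)) / of_real Q)" for y
    using Q by (simp add: norlund_kernel_def Q_def[symmetric] field_simps)
  have cylN: "cyl n (dirichlet j x)" if "j \<le> n" for j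
    using M_gt[of n] that by (intro cyl_dirichlet) simp
  have "cyl n (\<psi> (n - 1))"
    using M_gt[of n] by (intro cyl_vilenkin_fun) simp
  moreover have "cyl n S"
    unfolding S_def[abs_def] by (intro cyl_sum cyl_comp[where F = "\<lambda>v. q j *\<^sub>R v" for j] cylN) auto
  ultimately have int: "integrable \<mu> (\<lambda>y. - (u y * cnj (S y)) / of_real Q)"
    unfolding u_def
    by (intro integrable_cyl cyl_comp2[where F = "\<lambda>v w. - (\<psi> (n - 1) x * cnj v * cnj w) / of_real Q"])
  have "L1 (norlund_kernel q n x) \<le> L1 (dirichlet n x) + L1 (\<lambda>y. - (u y * cnj (S y)) / of_real Q)"
    unfolding K by (intro L1_add integrable_dirichlet int)
  also have "L1 (dirichlet n x) = 1"
    unfolding n_def by (rule L1_dirichlet_M[OF x])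
  also have "L1 (\<lambda>y. - (u y * cnj (S y)) / of_real Q) = L1 S / Q"
    using Q by (simp add: norm_mult norm_divide u)
  also have "L1 S / Q \<le> 3 * real B + 1"
    using L1_weighted_dirichlet[OF x B q(1,2), of n] Q
    by (simp add: S_def Q_def[symmetric] divide_le_eq)
  finally show ?thesis by (simp add: n_def)
qed

end

subsection \<open>Schur's test\<close>

text \<open>Convexity of the power function, as the tangent line at \<open>u\<close>. For
  \<open>p > 1\<close> this is Young's inequality for \<open>t\<close> and
  \<open>u powr (p - 1)\<close>, with conjugate exponent \<open>r\<close>.\<close>

lemma powr_ge_tangent:
  fixes t u p :: real
  assumes "p \<ge> 1" "t \<ge> 0" "u > 0"
  shows "u powr p + p * u powr (p - 1) * (t - u) \<le> t powr p"
proof (cases "p = 1")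
  case True
  then show ?thesis using assms by simp
next
  case False
  then have p: "p > 1" using assms by simp
  define r where "r = p / (p - 1)"
  have r: "r > 1" "1 / p + 1 / r = 1" "1 / r = (p - 1) / p" "(p - 1) * r = p"
    using p by (auto simp: r_def field_simps)
  have "t * u powr (p - 1) \<le> t powr p / p + (u powr (p - 1)) powr r / r"
    using p r assms by (intro Youngs_inequality) auto
  also have "(u powr (p - 1)) powr r / r = u powr p * (1 / r)"
    by (simp add: powr_powr r(4))
  finally have "p * (t * u powr (p - 1)) \<le> p * (t powr p / p + u powr p * ((p - 1) / p))"
    using p r(3) by (intro mult_left_mono) auto
  also have "\<dots> = t powr p + (p - 1) * u powr p"
    using p by (simp add: field_simps)
  finally have "p * (t * u powr (p - 1)) \<le> t powr p + (p - 1) * u powr p" .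
  moreover have "u powr (p - 1) * u = u powr p"
    using assms(3) powr_mult_base[of u "p - 1"] by (simp add: mult.commute)
  ultimately show ?thesis
    by (simp add: algebra_simps)
qed

text \<open>Jensen's inequality for the measure with density \<open>w\<close>, whose mass is only
  bounded by \<open>A\<close>: the tangent inequality at \<open>u\<close>, the integral divided by
  \<open>A\<close>, is integrated against \<open>w\<close>.\<close>

lemma powr_integral_le:
  fixes w t :: "'a \<Rightarrow> real"
  assumes p: "p \<ge> 1" and A: "A > 0" "integral\<^sup>L M w \<le> A"
    and w: "\<And>y. w y \<ge> 0" and t: "\<And>y. t y \<ge> 0"
    and int: "integrable M w" "integrable M (\<lambda>y. w y * t y)" "integrable M (\<lambda>y. w y * t y powr p)"
  shows "(LINT y|M. w y * t y) powr p \<le> A powr (p - 1) * (LINT y|M. w y * t y powr p)"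
proof -
  let ?I = "LINT y|M. w y * t y" and ?J = "LINT y|M. w y * t y powr p"
  have I: "?I \<ge> 0" and J: "?J \<ge> 0" using w t by (auto intro!: integral_nonneg_AE)
  show ?thesis
  proof (cases "?I = 0")
    case True
    then show ?thesis using J A by simp
  next
    case False
    define u where "u = ?I / A"
    have u: "u > 0" and Iu: "?I = u * A" using False I A by (auto simp: u_def)
    have W: "integral\<^sup>L M w \<ge> 0" using w by (auto intro!: integral_nonneg_AE)
    have up: "u powr (p - 1) * u = u powr p"
      using u powr_mult_base[of u "p - 1"] by (simp add: mult.commute)
    have "(LINT y|M. u powr p * w y + p * u powr (p - 1) * (w y * t y - u * w y)) \<le> ?J"
    proof (rule integral_mono)
      fix y
      have "w y * (u powr p + p * u powr (p - 1) * (t y - u)) \<le> w y * t y powr p"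
        using p u w t by (intro mult_left_mono powr_ge_tangent) auto
      then show "u powr p * w y + p * u powr (p - 1) * (w y * t y - u * w y) \<le> w y * t y powr p"
        by (simp add: algebra_simps)
    qed (use int in auto)
    also have "(LINT y|M. u powr p * w y + p * u powr (p - 1) * (w y * t y - u * w y))
        = u powr p * integral\<^sup>L M w + p * u powr (p - 1) * (?I - u * integral\<^sup>L M w)"
      using int by simp
    also have "\<dots> = u powr p * integral\<^sup>L M w + p * (u powr (p - 1) * u) * (A - integral\<^sup>L M w)"
      unfolding Iu by (simp add: algebra_simps)
    \<comment> \<open>The missing mass, \<open>A\<close> minus the integral of \<open>w\<close>,
      appears with a nonnegative coefficient and can be discarded.\<close>
    also have "\<dots> = u powr p * A + (p - 1) * (u powr p * (A - integral\<^sup>L M w))"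
      unfolding up by (simp add: algebra_simps)
    finally have "u powr p * A \<le> ?J"
      using p A(2) by (smt (verit) mult_nonneg_nonneg powr_ge_zero)
    then have "A powr (p - 1) * (u powr p * A) \<le> A powr (p - 1) * ?J"
      by (intro mult_left_mono) auto
    also have "A powr (p - 1) * (u powr p * A) = u powr p * A powr p"
      using A powr_mult_base[of A "p - 1"] by (simp add: mult_ac)
    also have "\<dots> = ?I powr p"
      using u A by (simp add: Iu powr_mult)
    finally show ?thesis .
  qed
qed

text \<open>Jensen with weight \<open>norm (K x y)\<close> in \<open>y\<close> uses the row bound
  and gives \<open>A powr (p - 1)\<close>; after exchanging the integrals the column bound gives the
  last factor \<open>A\<close>. The bound \<open>C\<close> makes the products of the kernel with
  integrable functions integrable.\<close>

lemma (in prob_space) schur_test: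
  fixes K :: "'a \<Rightarrow> 'a \<Rightarrow> complex" and f :: "'a \<Rightarrow> complex"
  assumes p: "p \<ge> 1" and A: "A > 0"
    and f: "integrable M f" "integrable M (\<lambda>x. norm (f x) powr p)"
    and K [measurable]: "(\<lambda>(x, y). K x y) \<in> borel_measurable (M \<Otimes>\<^sub>M M)"
    and bdd: "\<And>x y. norm (K x y) \<le> C"
    and row: "\<And>x. x \<in> space M \<Longrightarrow> (LINT y|M. norm (K x y)) \<le> A"
    and col: "\<And>y. y \<in> space M \<Longrightarrow> (LINT x|M. norm (K x y)) \<le> A"
  shows "(LINT x|M. norm (LINT y|M. f y * K x y) powr p) \<le> A powr p * (LINT x|M. norm (f x) powr p)"
proof (rule integral_real_bounded)
  have [measurable]: "f \<in> borel_measurable M" using f by auto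
  have Krow [measurable]: "K x \<in> borel_measurable M" if "x \<in> space M" for x
    using measurable_compose[OF measurable_Pair1'[OF that] K] by simp
  have Kcol [measurable]: "(\<lambda>x. K x y) \<in> borel_measurable M" if "y \<in> space M" for y
    using measurable_compose[OF measurable_Pair2'[OF that] K] by simp
  have introw: "integrable M (\<lambda>y. norm (K x y))" if "x \<in> space M" for x
    using that bdd by (intro integrable_const_bound[where B = C]) auto
  have intcol: "integrable M (\<lambda>x. norm (K x y))" if "y \<in> space M" for y
    using that bdd by (intro integrable_const_bound[where B = C]) auto
  have intm: "integrable M (\<lambda>y. norm (K x y) * g y)"
    if x: "x \<in> space M" and g: "integrable M g" "\<And>y. g y \<ge> 0" for x and g :: "'a \<Rightarrow> real"
  proof (rule Bochner_Integration.integrable_bound)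
    show "integrable M (\<lambda>y. C * g y)" using g by simp
    have [measurable]: "g \<in> borel_measurable M" using g by auto
    show "(\<lambda>y. norm (K x y) * g y) \<in> borel_measurable M" using x by measurable
    show "AE y in M. norm (norm (K x y) * g y) \<le> norm (C * g y)"
      using g bdd by (auto simp: abs_mult intro!: mult_right_mono order_trans[OF bdd])
  qed
  let ?F = "\<lambda>x y. A powr (p - 1) * (norm (K x y) * norm (f y) powr p)"
  have pt: "norm (LINT y|M. f y * K x y) powr p \<le> (LINT y|M. ?F x y)"
    if x: "x \<in> space M" for x
  proof -
    have "norm (LINT y|M. f y * K x y) \<le> (LINT y|M. norm (f y * K x y))"
      by (rule integral_norm_bound)
    also have "\<dots> = (LINT y|M. norm (K x y) * norm (f y))"
      by (simp add: norm_mult mult.commute)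
    finally have "norm (LINT y|M. f y * K x y) powr p \<le> (LINT y|M. norm (K x y) * norm (f y)) powr p"
      using p by (intro powr_mono2) auto
    also have "\<dots> \<le> A powr (p - 1) * (LINT y|M. norm (K x y) * norm (f y) powr p)"
      using f by (intro powr_integral_le p A row x introw intm) auto
    finally show ?thesis by simp
  qed
  \<comment> \<open>Passing to nonnegative integrals allows the exchange of order without
    integrability on the product space.\<close>
  have "(\<integral>\<^sup>+x. ennreal (norm (LINT y|M. f y * K x y) powr p) \<partial>M)
      \<le> (\<integral>\<^sup>+x. \<integral>\<^sup>+y. ennreal (?F x y) \<partial>M \<partial>M)"
  proof (rule nn_integral_mono)
    fix x assume x: "x \<in> space M"
    have "(\<integral>\<^sup>+y. ennreal (?F x y) \<partial>M) = ennreal (LINT y|M. ?F x y)"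
      using f x by (intro nn_integral_eq_integral integrable_mult_right intm) auto
    then show "ennreal (norm (LINT y|M. f y * K x y) powr p) \<le> (\<integral>\<^sup>+y. ennreal (?F x y) \<partial>M)"
      using pt[OF x] by (simp add: ennreal_leI)
  qed
  also have "\<dots> = (\<integral>\<^sup>+y. \<integral>\<^sup>+x. ennreal (?F x y) \<partial>M \<partial>M)"
    using pair_sigma_finite.Fubini'[of M M "\<lambda>y x. ennreal (?F x y)"] by (simp add: sigma_finite_measure_axioms pair_sigma_finite_def)
  also have "\<dots> \<le> (\<integral>\<^sup>+y. ennreal (A powr p * norm (f y) powr p) \<partial>M)"
  proof (rule nn_integral_mono)
    fix y assume y: "y \<in> space M"
    have "(\<integral>\<^sup>+x. ennreal (?F x y) \<partial>M) = ennreal (LINT x|M. ?F x y)"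
      using intcol[OF y] by (intro nn_integral_eq_integral) auto
    also have "(LINT x|M. ?F x y) = A powr (p - 1) * norm (f y) powr p * (LINT x|M. norm (K x y))"
      using intcol[OF y] by simp
    also have "\<dots> \<le> A powr (p - 1) * norm (f y) powr p * A"
      by (intro mult_left_mono col y) auto
    also have "\<dots> = A powr p * norm (f y) powr p"
      using A powr_mult_base[of A "p - 1"] by (simp add: mult_ac)
    finally show "(\<integral>\<^sup>+x. ennreal (?F x y) \<partial>M) \<le> ennreal (A powr p * norm (f y) powr p)"
      by (simp add: ennreal_leI)
  qed
  also have "\<dots> = ennreal (A powr p * (LINT x|M. norm (f x) powr p))"
    using f by (subst nn_integral_eq_integral) auto
  finally show "(\<integral>\<^sup>+x. ennreal (norm (LINT y|M. f y * K x y) powr p) \<partial>M)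
    \<le> ennreal (A powr p * (LINT x|M. norm (f x) powr p))" .
qed (simp add: A integral_nonneg_AE)

text \<open>A substitute for Minkowski's inequality at the level of p-th powers; the factor
  \<open>2 powr p\<close> does no harm in limit arguments.\<close>

lemma Lp_power_diff_le:
  assumes p: "p \<ge> 1" and f: "f \<in> Lp_space M p" and g: "g \<in> Lp_space M p"
  shows "(LINT x|M. norm (f x - g x) powr p)
    \<le> 2 powr p * ((LINT x|M. norm (f x) powr p) + (LINT x|M. norm (g x) powr p))"
proof -
  have "(LINT x|M. norm (f x - g x) powr p)
      \<le> (LINT x|M. 2 powr p * (norm (f x) powr p + norm (g x) powr p))"
  proof (rule integral_mono)
    fix x
    have "norm (f x - g x) \<le> 2 * max (norm (f x)) (norm (g x))"
      using norm_triangle_ineq4[of "f x" "g x"] by simp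
    then have "norm (f x - g x) powr p \<le> (2 * max (norm (f x)) (norm (g x))) powr p"
      using p by (intro powr_mono2) auto
    also have "\<dots> = 2 powr p * max (norm (f x)) (norm (g x)) powr p"
      by (subst powr_mult) auto
    also have "\<dots> \<le> 2 powr p * (norm (f x) powr p + norm (g x) powr p)"
      by (intro mult_left_mono) (auto simp: max_def)
    finally show "norm (f x - g x) powr p \<le> 2 powr p * (norm (f x) powr p + norm (g x) powr p)" .
  qed (use Lp_space_diff[OF f g p] f g in \<open>auto simp: Lp_space_def\<close>)
  also have "\<dots> = 2 powr p * ((LINT x|M. norm (f x) powr p) + (LINT x|M. norm (g x) powr p))"
    using f g by (simp add: Lp_space_def)
  finally show ?thesis .
qed

context vilenkin
begin

lemma bounded_in_Lp_space:
  assumes "f \<in> borel_measurable \<mu>" "\<And>x. x \<in> space \<mu> \<Longrightarrow> norm (f x) \<le> B" "p \<ge> 1"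
  shows "f \<in> Lp_space \<mu> p"
proof -
  have "integrable \<mu> (\<lambda>x. norm (f x) powr p)"
    using assms by (intro integrable_const_bound[where B = "B powr p"]) (auto intro!: powr_mono2)
  then show ?thesis using assms by (simp add: Lp_space_def)
qed

lemma cyl_in_Lp_space:
  assumes "cyl s g"
  shows "g \<in> Lp_space \<mu> p"
  using measurable_cyl[OF assms] integrable_cyl[OF cyl_comp[OF assms, of "\<lambda>v. norm v powr p"]]
  by (simp add: Lp_space_def)

subsection \<open>Density in \<open>L\<^sup>p\<close>\<close>

text \<open>The closure of the cylinder functions in \<open>L\<^sup>p\<close>. Membership in the
  space is included so that closure properties can be chained.\<close>

definition cyl_approx :: "real \<Rightarrow> ((nat \<Rightarrow> nat) \<Rightarrow> complex) \<Rightarrow> bool" where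
  "cyl_approx p f \<longleftrightarrow> f \<in> Lp_space \<mu> p \<and>
     (\<forall>e>0. \<exists>s g. cyl s g \<and> (LINT x|\<mu>. norm (f x - g x) powr p) < e)"

lemma cyl_approx_cyl: "cyl s g \<Longrightarrow> cyl_approx p g"
  unfolding cyl_approx_def by (auto simp: cyl_in_Lp_space intro!: exI[of _ s] exI[of _ g])

lemma cyl_approx_diff:
  assumes p: "p \<ge> 1" and f: "cyl_approx p f" and g: "cyl_approx p g"
  shows "cyl_approx p (\<lambda>x. f x - g x)"
  unfolding cyl_approx_def
proof (intro conjI allI impI)
  have fL: "f \<in> Lp_space \<mu> p" and gL: "g \<in> Lp_space \<mu> p"
    using f g by (auto simp: cyl_approx_def)
  then show "(\<lambda>x. f x - g x) \<in> Lp_space \<mu> p" using p by (rule Lp_space_diff)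
  fix e :: real assume e: "e > 0"
  \<comment> \<open>Two errors below \<open>d\<close>, multiplied by the factor
    \<open>2 powr p\<close> of \<open>Lp_power_diff_le\<close>, stay below \<open>e\<close>.\<close>
  define d where "d = e / (2 powr p * 2)"
  have d: "d > 0" using e by (simp add: d_def)
  obtain s h where h: "cyl s h" "(LINT x|\<mu>. norm (f x - h x) powr p) < d"
    using f d unfolding cyl_approx_def by blast
  obtain t k where k: "cyl t k" "(LINT x|\<mu>. norm (g x - k x) powr p) < d"
    using g d unfolding cyl_approx_def by blast
  have "cyl (max s t) (\<lambda>x. h x - k x)"
    by (intro cyl_comp2[where F = "(-)"] cyl_mono[OF h(1)] cyl_mono[OF k(1)]) auto
  moreover have "(LINT x|\<mu>. norm (f x - g x - (h x - k x)) powr p) < e"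
  proof -
    have "(LINT x|\<mu>. norm (f x - g x - (h x - k x)) powr p)
        = (LINT x|\<mu>. norm (f x - h x - (g x - k x)) powr p)"
      by (simp add: algebra_simps)
    also have "\<dots> \<le> 2 powr p * ((LINT x|\<mu>. norm (f x - h x) powr p) + (LINT x|\<mu>. norm (g x - k x) powr p))"
      by (intro Lp_power_diff_le Lp_space_diff p fL gL cyl_in_Lp_space[OF h(1)] cyl_in_Lp_space[OF k(1)])
    also have "\<dots> < 2 powr p * (d + d)"
      by (intro mult_strict_left_mono add_strict_mono h k) auto
    also have "\<dots> = e" by (simp add: d_def)
    finally show ?thesis .
  qed
  ultimately show "\<exists>s h. cyl s h \<and> (LINT x|\<mu>. norm (f x - g x - h x) powr p) < e" by blast
qed

lemma cyl_approx_add: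
  assumes p: "p \<ge> 1" and f: "cyl_approx p f" and g: "cyl_approx p g"
  shows "cyl_approx p (\<lambda>x. f x + g x)"
  using cyl_approx_diff[OF p f cyl_approx_diff[OF p cyl_approx_cyl[OF cyl_const[of 0 0]] g]] by simp

lemma cyl_approx_sum:
  assumes "p \<ge> 1" "finite I" "\<And>i. i \<in> I \<Longrightarrow> cyl_approx p (f i)"
  shows "cyl_approx p (\<lambda>x. \<Sum>i\<in>I. f i x)"
  using assms(2,3)
  by (induction rule: finite_induct) (auto intro!: cyl_approx_add assms(1) cyl_approx_cyl[OF cyl_const])

lemma cyl_approx_mult_const:
  assumes p: "p \<ge> 1" and f: "cyl_approx p f"
  shows "cyl_approx p (\<lambda>x. c * f x)"
proof (cases "c = 0")
  case True
  then show ?thesis using cyl_approx_cyl[OF cyl_const[of 0 0]] by simp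
next
  case False
  show ?thesis
    unfolding cyl_approx_def
  proof (intro conjI allI impI)
    show "(\<lambda>x. c * f x) \<in> Lp_space \<mu> p"
      using f by (auto simp: cyl_approx_def Lp_space_def norm_mult powr_mult)
    fix e :: real assume "e > 0"
    then have "e / norm c powr p > 0" using False by simp
    then obtain s g where g: "cyl s g" "(LINT x|\<mu>. norm (f x - g x) powr p) < e / norm c powr p"
      using f unfolding cyl_approx_def by blast
    have "(LINT x|\<mu>. norm (c * f x - c * g x) powr p) = norm c powr p * (LINT x|\<mu>. norm (f x - g x) powr p)"
      by (simp add: right_diff_distrib[symmetric] norm_mult powr_mult)
    also have "\<dots> < e" using g(2) False by (simp add: pos_less_divide_eq mult.commute)
    finally show "\<exists>s g. cyl s g \<and> (LINT x|\<mu>. norm (c * f x - g x) powr p) < e"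
      using cyl_comp[OF g(1), of "\<lambda>v. c * v"] by blast
  qed
qed

text \<open>Dominated convergence with majorant \<open>norm (w x) powr p\<close> brings some
  \<open>F i\<close> close to \<open>f\<close>; a cylinder function close to that \<open>F i\<close>
  is then close to \<open>f\<close>. Used for countable disjoint unions and for limits of simple
  functions.\<close>

lemma cyl_approx_dominated_lim:
  assumes p: "p \<ge> 1" and F: "\<And>i. cyl_approx p (F i)"
    and f: "f \<in> Lp_space \<mu> p" and w: "w \<in> Lp_space \<mu> p"
    and lim: "\<And>x. x \<in> space \<mu> \<Longrightarrow> (\<lambda>i. F i x) \<longlonglongrightarrow> f x"
    and bound: "\<And>i x. x \<in> space \<mu> \<Longrightarrow> norm (f x - F i x) \<le> norm (w x)"
  shows "cyl_approx p f"
  unfolding cyl_approx_def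
proof (intro conjI allI impI f)
  fix e :: real assume e: "e > 0"
  define d where "d = e / (2 powr p * 2)"
  have d: "d > 0" using e by (simp add: d_def)
  have FL: "F i \<in> Lp_space \<mu> p" for i using F by (simp add: cyl_approx_def)
  have "(\<lambda>i. LINT x|\<mu>. norm (f x - F i x) powr p) \<longlonglongrightarrow> (LINT x|\<mu>. 0)"
  proof (rule integral_dominated_convergence)
    show "integrable \<mu> (\<lambda>x. norm (w x) powr p)" using w by (simp add: Lp_space_def)
    show "(\<lambda>x. norm (f x - F i x) powr p) \<in> borel_measurable \<mu>" for i
      using Lp_space_diff[OF f FL p] by (auto simp: Lp_space_def)
    show "AE x in \<mu>. (\<lambda>i. norm (f x - F i x) powr p) \<longlonglongrightarrow> 0"
    proof (rule AE_I2)
      fix x assume "x \<in> space \<mu>"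
      then have "(\<lambda>i. norm (f x - F i x)) \<longlonglongrightarrow> norm (f x - f x)"
        by (intro tendsto_intros lim)
      then show "(\<lambda>i. norm (f x - F i x) powr p) \<longlonglongrightarrow> 0"
        using p tendsto_powr'[of "\<lambda>i. norm (f x - F i x)" 0 sequentially "\<lambda>_. p" p] by simp
    qed
    show "AE x in \<mu>. norm (norm (f x - F i x) powr p) \<le> norm (w x) powr p" for i
      using bound p by (auto intro!: powr_mono2)
  qed simp
  then have "\<forall>\<^sub>F i in sequentially. (LINT x|\<mu>. norm (f x - F i x) powr p) < d"
    using d by (intro order_tendstoD(2)) simp_all
  then obtain i where i: "(LINT x|\<mu>. norm (f x - F i x) powr p) < d"
    by (auto simp: eventually_sequentially)
  obtain s g where g: "cyl s g" "(LINT x|\<mu>. norm (F i x - g x) powr p) < d"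
    using F[of i] d unfolding cyl_approx_def by blast
  have gL: "g \<in> Lp_space \<mu> p" by (rule cyl_in_Lp_space[OF g(1)])
  have "(LINT x|\<mu>. norm (f x - g x) powr p) = (LINT x|\<mu>. norm ((f x - F i x) - (g x - F i x)) powr p)"
    by simp
  also have "\<dots> \<le> 2 powr p * ((LINT x|\<mu>. norm (f x - F i x) powr p) + (LINT x|\<mu>. norm (g x - F i x) powr p))"
    by (intro Lp_power_diff_le Lp_space_diff p f FL gL)
  also have "(LINT x|\<mu>. norm (g x - F i x) powr p) = (LINT x|\<mu>. norm (F i x - g x) powr p)"
    by (simp add: norm_minus_commute)
  also have "2 powr p * ((LINT x|\<mu>. norm (f x - F i x) powr p) + (LINT x|\<mu>. norm (F i x - g x) powr p))
      < 2 powr p * (d + d)"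
    by (intro mult_strict_left_mono add_strict_mono i g) auto
  also have "\<dots> = e" by (simp add: d_def)
  finally show "\<exists>s g. cyl s g \<and> (LINT x|\<mu>. norm (f x - g x) powr p) < e"
    using g(1) by blast
qed

text \<open>Dynkin's argument: the cylinder sets \<open>G\<close> are stable under intersection and
  generate the product sigma-algebra, and approximability passes to complements and countable
  disjoint unions.\<close>

lemma cyl_approx_indicator:
  assumes p: "p \<ge> 1" and A: "A \<in> sets \<mu>"
  shows "cyl_approx p (indicator A)"
proof -
  define G where "G = {A. A \<subseteq> space \<mu> \<and> (\<exists>s. cyl s (indicator A :: _ \<Rightarrow> complex))}"
  have G: "A \<in> sets \<mu>" if "A \<in> G" for A
  proof -
    obtain s where "cyl s (indicator A :: _ \<Rightarrow> complex)" "A \<subseteq> space \<mu>"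
      using \<open>A \<in> G\<close> by (auto simp: G_def)
    then show ?thesis
      using measurable_cyl[of s "indicator A :: _ \<Rightarrow> complex"]
      by (simp add: borel_measurable_indicator_iff Int_absorb2)
  qed
  have "sets \<mu> \<subseteq> sigma_sets (space \<mu>) G"
    unfolding vilenkin_measure_def sets_PiM_single
    unfolding space_PiM[symmetric] vilenkin_measure_def[symmetric]
  proof (rule sigma_sets_mono')
    show "{{f \<in> space \<mu>. f i \<in> A} |i A. i \<in> UNIV \<and> A \<in> sets (uniform_count_measure {..<m i})} \<subseteq> G"
    proof safe
      fix i A
      have "cyl (Suc i) (indicator {f \<in> space \<mu>. f i \<in> A} :: _ \<Rightarrow> complex)"
        by (auto simp: cyl_def indicator_def)
      then show "{f \<in> space \<mu>. f i \<in> A} \<in> G" by (auto simp: G_def)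
    qed
  qed
  then have sig: "A \<in> sigma_sets (space \<mu>) G" using A by blast
  have "Int_stable G"
  proof (rule Int_stableI)
    fix a b assume "a \<in> G" "b \<in> G"
    then obtain s t where st: "cyl s (indicator a :: _ \<Rightarrow> complex)" "cyl t (indicator b :: _ \<Rightarrow> complex)"
      "a \<subseteq> space \<mu>" by (auto simp: G_def)
    have "cyl (max s t) (\<lambda>x. indicator a x * indicator b x :: complex)"
      by (intro cyl_comp2[where F = "(*)"] cyl_mono[OF st(1)] cyl_mono[OF st(2)]) auto
    then show "a \<inter> b \<in> G" using st(3)
      by (auto simp: G_def indicator_inter_arith[symmetric, abs_def])
  qed
  moreover have "G \<subseteq> Pow (space \<mu>)" by (auto simp: G_def)
  ultimately have "A \<in> sets \<mu> \<and> cyl_approx p (indicator A)"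
    using sig
  proof (induction rule: sigma_sets_induct_disjoint)
    case (basic A)
    then show ?case using G by (auto simp: G_def intro: cyl_approx_cyl)
  next
    case empty
    then show ?case using cyl_approx_cyl[OF cyl_const[of 0 0]] by (simp add: indicator_def)
  next
    case (compl A)
    then have A: "A \<in> sets \<mu>" "cyl_approx p (indicator A)" by auto
    have "cyl 0 (indicator (space \<mu>) :: _ \<Rightarrow> complex)" by (auto simp: cyl_def)
    then have "cyl_approx p (\<lambda>x. indicator (space \<mu>) x - indicator A x)"
      by (intro cyl_approx_diff p A cyl_approx_cyl)
    moreover have "(\<lambda>x. indicator (space \<mu>) x - indicator A x :: complex) = indicator (space \<mu> - A)"
      using sets.sets_into_space[OF A(1)] by (auto simp: indicator_def fun_eq_iff)
    ultimately show ?case using A by auto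
  next
    case (union A)
    then have A: "A i \<in> sets \<mu>" "cyl_approx p (indicator (A i))" for i by auto
    have U: "(\<Union>i. A i) \<in> sets \<mu>" using A by auto
    have "cyl_approx p (indicator (\<Union>i. A i))"
    proof (rule cyl_approx_dominated_lim[OF p])
      show "cyl_approx p (\<lambda>x. \<Sum>i<n. indicator (A i) x)" for n
        by (intro cyl_approx_sum p A) auto
      show "(indicator (\<Union>i. A i) :: _ \<Rightarrow> complex) \<in> Lp_space \<mu> p"
        using U p by (intro bounded_in_Lp_space[where B = 1]) (auto simp: indicator_def)
      show "(\<lambda>_. 1 :: complex) \<in> Lp_space \<mu> p"
        by (rule cyl_in_Lp_space[OF cyl_const])
      have disj: "disjoint_family_on A {..<n}" for n
        using union by (auto simp: disjoint_family_on_def)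
      have sum: "(\<Sum>i<n. indicator (A i) x) = (indicator (\<Union>i<n. A i) x :: complex)" for n x
        using disj[of n] by (simp add: indicator_UN_disjoint)
      show "norm ((indicator (\<Union>i. A i) x :: complex) - (\<Sum>i<n. indicator (A i) x)) \<le> norm (1 :: complex)" for n x
        unfolding sum by (auto simp: indicator_def)
      show "(\<lambda>n. \<Sum>i<n. indicator (A i) x) \<longlonglongrightarrow> (indicator (\<Union>i. A i) x :: complex)" for x
        unfolding sum by (rule LIMSEQ_indicator_UN)
    qed
    with U show ?case by blast
  qed
  then show ?thesis ..
qed

lemma cyl_approx_Lp:
  assumes p: "p \<ge> 1" and f: "f \<in> Lp_space \<mu> p"
  shows "cyl_approx p f"
proof -
  have [measurable]: "f \<in> borel_measurable \<mu>" using f by (simp add: Lp_space_def)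
  obtain F where F: "\<And>i. simple_function \<mu> (F i)"
    "\<And>x. x \<in> space \<mu> \<Longrightarrow> (\<lambda>i. F i x) \<longlonglongrightarrow> f x"
    "\<And>i x. x \<in> space \<mu> \<Longrightarrow> norm (F i x) \<le> 2 * norm (f x)"
    using borel_measurable_implies_sequence_metric[of f \<mu> 0] by auto metis
  \<comment> \<open>The simple function is rewritten as a linear combination of indicators, to which
    the closure properties apply.\<close>
  define F' where "F' i x = (\<Sum>c\<in>F i ` space \<mu>. c * indicator (F i -` {c} \<inter> space \<mu>) x)" for i x
  have F': "F' i x = F i x" if "x \<in> space \<mu>" for i x
  proof -
    have "F' i x = (\<Sum>c\<in>F i ` space \<mu>. if c = F i x then c else 0)"
      unfolding F'_def using that by (intro sum.cong) (auto simp: indicator_def)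
    then show ?thesis using that simple_functionD(1)[OF F(1)[of i]] by simp
  qed
  show ?thesis
  proof (rule cyl_approx_dominated_lim[OF p _ f])
    show "cyl_approx p (F' i)" for i
      unfolding F'_def[abs_def]
      by (intro cyl_approx_sum cyl_approx_mult_const cyl_approx_indicator p
          simple_functionD[OF F(1)])
    \<comment> \<open>The factor 3 is 1 for \<open>f\<close> plus 2 from the bound on
      \<open>F i\<close>.\<close>
    show "(\<lambda>x. 3 * f x) \<in> Lp_space \<mu> p"
      using f by (auto simp: Lp_space_def norm_mult powr_mult)
    show "(\<lambda>i. F' i x) \<longlonglongrightarrow> f x" if "x \<in> space \<mu>" for x
      using F(2)[OF that] F'[OF that] by simp
    show "norm (f x - F' i x) \<le> norm (3 * f x)" if "x \<in> space \<mu>" for i x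
      using F(3)[OF that, of i] norm_triangle_ineq4[of "f x" "F i x"] F'[OF that]
      by (simp add: norm_mult)
  qed
qed


subsection \<open>Convergence of the means\<close>

declare measurable_vilenkin_fun [measurable del]

lemma measurable_\<psi> [measurable]: "\<psi> n \<in> borel_measurable \<mu>"
  by (rule measurable_vilenkin_fun[OF m_ge2])

lemma measurable_cnj [measurable]: "cnj \<in> borel_measurable borel"
  by (intro borel_measurable_continuous_onI continuous_intros)

lemma norm_\<psi> [simp]: "norm (\<psi> n x) = 1"
  by (rule norm_vilenkin_fun[OF m_ge2])

lemma Lp_space_integrable:
  assumes f: "f \<in> Lp_space \<mu> p" and p: "p \<ge> 1"
  shows "integrable \<mu> f"
proof (rule Bochner_Integration.integrable_bound)
  show "integrable \<mu> (\<lambda>x. 1 + norm (f x) powr p)" "f \<in> borel_measurable \<mu>"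
    using f by (auto simp: Lp_space_def)
  \<comment> \<open>The constant 1 is integrable because the measure is finite.\<close>
  have "norm (f x) \<le> 1 + norm (f x) powr p" for x
  proof (cases "norm (f x) \<le> 1")
    case False
    then have "norm (f x) powr 1 \<le> norm (f x) powr p" using p by (intro powr_mono) auto
    then show ?thesis using False by simp
  qed (simp add: add_increasing2)
  then show "AE x in \<mu>. norm (f x) \<le> norm (1 + norm (f x) powr p)" by simp
qed

section \<open>Means as integral operators and their uniform boundedness\<close>

lemma integrable_mult_\<psi>:
  assumes f: "integrable \<mu> f"
  shows "integrable \<mu> (\<lambda>x. f x * cnj (\<psi> k x))"
  using f by (intro Bochner_Integration.integrable_bound[OF f]) (auto simp: norm_mult)

lemma partial_sum_kernel:
  assumes f: "integrable \<mu> f"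
  shows "vilenkin_partial_sum m f n x = (LINT y|\<mu>. f y * dirichlet n x y)"
    and integrable_mult_dirichlet: "integrable \<mu> (\<lambda>y. f y * dirichlet n x y)"
proof -
  have e: "f y * dirichlet n x y = (\<Sum>k<n. f y * cnj (\<psi> k y) * \<psi> k x)" for y
    by (simp add: dirichlet_def sum_distrib_left mult_ac)
  have int: "integrable \<mu> (\<lambda>y. f y * cnj (\<psi> k y) * \<psi> k x)" for k
    by (intro integrable_mult_left integrable_mult_\<psi> f)
  show "integrable \<mu> (\<lambda>y. f y * dirichlet n x y)"
    unfolding e by (intro Bochner_Integration.integrable_sum int)
  show "vilenkin_partial_sum m f n x = (LINT y|\<mu>. f y * dirichlet n x y)"
    unfolding e vilenkin_partial_sum_def vilenkin_coeff_def
    by (subst Bochner_Integration.integral_sum) (auto intro!: int)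
qed

lemma norlund_mean_kernel:
  assumes f: "integrable \<mu> f"
  shows "norlund_mean m q f n x = (LINT y|\<mu>. f y * norlund_kernel q n x y)"
proof -
  define Q :: complex where "Q = of_real (\<Sum>k<n. q k)"
  have e: "f y * norlund_kernel q n x y
      = 1 / Q * (\<Sum>k=1..n. of_real (q (n - k)) * (f y * dirichlet k x y))" for y
    by (simp add: norlund_kernel_def Q_def sum_distrib_left mult_ac)
  have "(LINT y|\<mu>. f y * norlund_kernel q n x y)
      = 1 / Q * (\<Sum>k=1..n. of_real (q (n - k)) * (LINT y|\<mu>. f y * dirichlet k x y))"
    unfolding e by (subst integral_mult_right_zero, subst Bochner_Integration.integral_sum)
      (auto intro!: integrable_mult_dirichlet f)
  then show ?thesis
    by (simp add: norlund_mean_def Q_def partial_sum_kernel[OF f])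
qed

text \<open>Hermitian symmetry, as the weights are real; it turns the row bound into the column
  bound in Schur's test.\<close>

lemma norlund_kernel_flip: "norlund_kernel q n x y = cnj (norlund_kernel q n y x)"
  by (simp add: norlund_kernel_def dirichlet_def mult_ac)

lemma norlund_mean_Lp_bound:
  assumes p: "p \<ge> 1" and f: "f \<in> Lp_space \<mu> p"
    and B: "\<And>k. m k \<le> B" and q: "\<And>k. q k \<ge> 0" "decseq q" "q 0 > 0"
  shows "(LINT x|\<mu>. norm (norlund_mean m q f (M s) x) powr p)
    \<le> (3 * real B + 2) powr p * (LINT x|\<mu>. norm (f x) powr p)"
  unfolding norlund_mean_kernel[OF Lp_space_integrable[OF f p]]
proof (rule schur_test[OF p])
  \<comment> \<open>This pointwise bound depends on \<open>s\<close>; the constant in the conclusion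
    comes from the row and column bounds and does not.\<close>
  let ?C = "norm (1 / of_real (\<Sum>k<M s. q k) :: complex) * (\<Sum>k=1..M s. q (M s - k) * k)"
  have d: "norm (dirichlet k x y) \<le> k" for k x y
    unfolding dirichlet_def by (rule order_trans[OF norm_sum]) (simp add: norm_mult)
  show "norm (norlund_kernel q (M s) x y) \<le> ?C" for x y
    unfolding norlund_kernel_def norm_mult
    using q(1) d by (intro mult_left_mono order_trans[OF norm_sum] sum_mono)
      (auto simp: norm_mult intro!: mult_left_mono)
  show "(\<lambda>(x, y). norlund_kernel q (M s) x y) \<in> borel_measurable (\<mu> \<Otimes>\<^sub>M \<mu>)"
    unfolding norlund_kernel_def dirichlet_def by measurable
  show row: "L1 (norlund_kernel q (M s) x) \<le> 3 * real B + 2" if "x \<in> space \<mu>" for x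
    by (rule L1_norlund_kernel[OF that B q])
  show "(LINT x|\<mu>. norm (norlund_kernel q (M s) x y)) \<le> 3 * real B + 2" if "y \<in> space \<mu>" for y
    using row[OF that] by (subst norlund_kernel_flip) simp
qed (use f p in \<open>auto simp: Lp_space_integrable Lp_space_def\<close>)

section \<open>Partial sums and means of cylinder functions\<close>

text \<open>The kernel vanishes unless \<open>y\<close> agrees with \<open>x\<close> in the first
  \<open>s\<close> coordinates, and there \<open>g y = g x\<close>. What remains is the integral of
  the kernel, which is 1.\<close>

lemma partial_sum_cyl:
  assumes g: "cyl s g" and x: "x \<in> space \<mu>"
  shows "vilenkin_partial_sum m g (M s) x = g x"
proof -
  have "vilenkin_partial_sum m g (M s) x = (LINT y|\<mu>. g y * dirichlet (M s) x y)"
    by (rule partial_sum_kernel[OF integrable_cyl[OF g]])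
  also have "\<dots> = (LINT y|\<mu>. g x * dirichlet (M s) x y)"
  proof (rule Bochner_Integration.integral_cong[OF refl])
    fix y assume y: "y \<in> space \<mu>"
    show "g y * dirichlet (M s) x y = g x * dirichlet (M s) x y"
    proof (cases "\<forall>i<s. y i = x i")
      case True
      then show ?thesis using g x y unfolding cyl_def by metis
    next
      case False
      then show ?thesis using dirichlet_M_eq_0[OF x y] by auto
    qed
  qed
  finally show ?thesis by (simp add: integral_dirichlet_M[OF x])
qed

text \<open>As \<open>cyl s g\<close> implies \<open>cyl t g\<close> for \<open>t \<ge> s\<close>, Parseval's identity
  \<open>\<parallel>g\<parallel>\<^sup>2 = (\<Sum>k<M t. \<bar>vilenkin_coeff m g k\<bar>\<^sup>2)\<close> holds for all \<open>t \<ge> s\<close>, so no coefficient beyond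
  \<open>M s\<close> contributes; this avoids proving orthogonality of the system.\<close>

lemma vilenkin_coeff_cyl_eq_0:
  assumes g: "cyl s g" and k: "k \<ge> M s"
  shows "vilenkin_coeff m g k = 0"
proof -
  let ?c = "vilenkin_coeff m g"
  have parseval: "(LINT x|\<mu>. g x * cnj (g x)) = of_real (\<Sum>k<M t. (norm (?c k))\<^sup>2)" if t: "s \<le> t" for t
  proof -
    have gt: "cyl t g" using g t by (rule cyl_mono)
    \<comment> \<open>Only the first factor is expanded, by \<open>partial_sum_cyl\<close> at level
      \<open>t\<close>.\<close>
    have "(LINT x|\<mu>. g x * cnj (g x)) = (LINT x|\<mu>. (\<Sum>k<M t. ?c k * cnj (g x * cnj (\<psi> k x))))"
      by (intro Bochner_Integration.integral_cong refl)
        (simp add: partial_sum_cyl[OF gt, symmetric] vilenkin_partial_sum_def sum_distrib_right mult_ac)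
    also have "\<dots> = (\<Sum>k<M t. (LINT x|\<mu>. ?c k * cnj (g x * cnj (\<psi> k x))))"
      by (intro Bochner_Integration.integral_sum integrable_mult_right integrable_cnj
          integrable_mult_\<psi> integrable_cyl[OF g])
    also have "\<dots> = (\<Sum>k<M t. ?c k * cnj (?c k))"
      by (simp only: integral_mult_right_zero Bochner_Integration.integral_cnj vilenkin_coeff_def)
    finally show ?thesis by (simp only: of_real_sum complex_norm_square)
  qed
  define t where "t = max s (Suc k)"
  have t: "s \<le> t" "k < M t" using M_gt[of t] by (auto simp: t_def)
  have st: "M s \<le> M t" using t(1) by (rule M_mono)
  have "(\<Sum>k<M t. (norm (?c k))\<^sup>2) = (\<Sum>k<M s. (norm (?c k))\<^sup>2)"
    using parseval[OF t(1)] parseval[OF order_refl] by (simp del: of_real_sum)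
  moreover have "(\<Sum>k<M t. (norm (?c k))\<^sup>2)
      = (\<Sum>k<M s. (norm (?c k))\<^sup>2) + (\<Sum>k\<in>{M s..<M t}. (norm (?c k))\<^sup>2)"
    using st by (simp add: lessThan_atLeast0 sum.atLeastLessThan_concat)
  ultimately have "(\<Sum>k\<in>{M s..<M t}. (norm (?c k))\<^sup>2) = 0" by simp
  then show ?thesis
    using k t by (subst (asm) sum_nonneg_eq_0_iff) auto
qed

lemma partial_sum_cyl_ge:
  assumes g: "cyl s g" and x: "x \<in> space \<mu>" and n: "n \<ge> M s"
  shows "vilenkin_partial_sum m g n x = g x"
proof -
  have "vilenkin_partial_sum m g n x = vilenkin_partial_sum m g (M s) x"
    unfolding vilenkin_partial_sum_def
    using n by (intro sum.mono_neutral_right) (auto simp: vilenkin_coeff_cyl_eq_0[OF g])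
  then show ?thesis by (simp add: partial_sum_cyl[OF g x])
qed

text \<open>Terms with \<open>k \<ge> M s\<close> vanish, since those partial sums are exact. Each
  of the fewer than \<open>M s\<close> remaining ones has error at most \<open>C\<close> and
  relative weight at most \<open>1 / (n - M s)\<close>.\<close>

lemma norlund_mean_cyl:
  assumes g: "cyl s g" and x: "x \<in> space \<mu>" and n: "n > M s"
    and q: "\<And>k. q k \<ge> 0" "decseq q" "q 0 > 0"
  shows "norm (norlund_mean m q g n x - g x)
    \<le> real (M s) * (\<Sum>k<M s. norm (vilenkin_coeff m g k)) / real (n - M s)"
proof -
  define C where "C = (\<Sum>k<M s. norm (vilenkin_coeff m g k))"
  define Q where "Q = (\<Sum>k<n. q k)"
  let ?S = "\<lambda>k. vilenkin_partial_sum m g k x"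
  have C: "C \<ge> 0" by (simp add: C_def sum_nonneg)
  have Q: "Q > 0"
    unfolding Q_def using q n by (intro sum_pos2[of _ 0]) auto
  have Q': "Q = (\<Sum>k=1..n. q (n - k))"
    unfolding Q_def by (rule sum.reindex_bij_witness[of _ "\<lambda>j. n - j" "\<lambda>k. n - k"]) auto
  have diff: "norm (?S k - g x) \<le> C" if k: "k < M s" for k
  proof -
    have "?S k - g x = - (\<Sum>j\<in>{k..<M s}. vilenkin_coeff m g j * \<psi> j x)"
      using k sum.atLeastLessThan_concat[of 0 k "M s" "\<lambda>j. vilenkin_coeff m g j * \<psi> j x"]
      by (simp add: partial_sum_cyl[OF g x, symmetric] vilenkin_partial_sum_def
          lessThan_atLeast0 algebra_simps)
    then have "norm (?S k - g x) \<le> (\<Sum>j\<in>{k..<M s}. norm (vilenkin_coeff m g j))"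
      by (auto intro!: sum_norm_le simp: norm_mult)
    also have "\<dots> \<le> C" unfolding C_def by (intro sum_mono2) auto
    finally show ?thesis .
  qed
  \<comment> \<open>By monotonicity \<open>q (n - k)\<close> is the smallest of the first
    \<open>n - k + 1\<close> weights. As \<open>k \<ge> 1\<close>, these all occur in
    \<open>Q\<close>.\<close>
  have weight: "q (n - k) * real (n - M s) \<le> Q" if k: "1 \<le> k" "k < M s" for k
  proof -
    have "q (n - k) * real (n - M s) \<le> q (n - k) * real (Suc (n - k))"
      using k n q(1) by (intro mult_left_mono) auto
    also have "\<dots> = (\<Sum>i<Suc (n - k). q (n - k))" by simp
    also have "\<dots> \<le> (\<Sum>i<Suc (n - k). q i)"
      using q(2) by (intro sum_mono) (auto simp: decseq_def)
    also have "\<dots> \<le> Q"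
      unfolding Q_def using k n q(1) by (intro sum_mono2) auto
    finally show ?thesis .
  qed
  have "norlund_mean m q g n x - g x = 1 / of_real Q * (\<Sum>k=1..n. of_real (q (n - k)) * (?S k - g x))"
  proof -
    have "(\<Sum>k=1..n. of_real (q (n - k)) * (?S k - g x))
        = (\<Sum>k=1..n. of_real (q (n - k)) * ?S k) - of_real Q * g x"
      unfolding Q' by (simp add: right_diff_distrib sum_subtractf sum_distrib_right)
    then show ?thesis using Q by (simp add: norlund_mean_def Q_def[symmetric] field_simps)
  qed
  also have "(\<Sum>k=1..n. of_real (q (n - k)) * (?S k - g x))
      = (\<Sum>k\<in>{1..<M s}. of_real (q (n - k)) * (?S k - g x))"
    using n by (intro sum.mono_neutral_right) (auto simp: partial_sum_cyl_ge[OF g x])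
  finally have "norm (norlund_mean m q g n x - g x)
      = norm (\<Sum>k\<in>{1..<M s}. of_real (q (n - k)) * (?S k - g x)) / Q"
    using Q by (simp add: norm_divide norm_mult)
  also have "\<dots> \<le> (\<Sum>k\<in>{1..<M s}. Q / real (n - M s) * C) / Q"
  proof (intro divide_right_mono sum_norm_le)
    fix k assume k: "k \<in> {1..<M s}"
    have "q (n - k) \<le> Q / real (n - M s)"
      using weight[of k] k n by (simp add: pos_le_divide_eq)
    then have "q (n - k) * norm (?S k - g x) \<le> Q / real (n - M s) * C"
      using k Q diff[of k] q(1)[of "n - k"] by (intro mult_mono) auto
    then show "norm (of_real (q (n - k)) * (?S k - g x)) \<le> Q / real (n - M s) * C"
      using q(1) by (simp add: norm_mult)
  qed (use Q in simp)
  also have "\<dots> = real (M s - 1) * C / real (n - M s)"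
    using Q by (simp add: field_simps)
  also have "\<dots> \<le> real (M s) * C / real (n - M s)"
    using C by (intro divide_right_mono mult_right_mono) auto
  finally show ?thesis by (simp add: C_def)
qed

lemma norlund_mean_cyl_tendsto:
  assumes g: "cyl s g" and p: "p \<ge> 1" and q: "\<And>k. q k \<ge> 0" "decseq q" "q 0 > 0"
  shows "(\<lambda>n. LINT x|\<mu>. norm (norlund_mean m q g (M n) x - g x) powr p) \<longlonglongrightarrow> 0"
proof (rule tendsto_sandwich[where f = "\<lambda>_. 0"])
  define C where "C = real (M s) * (\<Sum>k<M s. norm (vilenkin_coeff m g k))"
  have C: "C \<ge> 0" by (simp add: C_def sum_nonneg)
  \<comment> \<open>Since \<open>M n > n\<close>, the bound at \<open>M n\<close> may be weakened to
    one whose convergence is immediate.\<close>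
  have M: "M n - M s \<ge> n - M s" for n using M_gt[of n] by simp
  show "\<forall>\<^sub>F n in sequentially. (LINT x|\<mu>. norm (norlund_mean m q g (M n) x - g x) powr p)
      \<le> (C / real (n - M s)) powr p"
    using eventually_gt_at_top[of "M s"]
  proof eventually_elim
    case (elim n)
    have gL: "g \<in> Lp_space \<mu> p" by (rule cyl_in_Lp_space[OF g])
    have "(LINT x|\<mu>. norm (norlund_mean m q g (M n) x - g x) powr p)
        \<le> (LINT x|\<mu>. (C / real (n - M s)) powr p)"
    proof (rule integral_mono)
      show "integrable \<mu> (\<lambda>x. norm (norlund_mean m q g (M n) x - g x) powr p)"
        using norlund_diff_in_Lp_space[OF m_ge2 p gL] by (simp add: Lp_space_def)
      fix x assume x: "x \<in> space \<mu>"
      have "norm (norlund_mean m q g (M n) x - g x) \<le> C / real (M n - M s)"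
        using norlund_mean_cyl[OF g x _ q, of "M n"] elim M_gt[of n] by (simp add: C_def)
      also have "\<dots> \<le> C / real (n - M s)"
        using C M[of n] elim by (intro divide_left_mono mult_pos_pos) auto
      finally show "norm (norlund_mean m q g (M n) x - g x) powr p \<le> (C / real (n - M s)) powr p"
        using p by (intro powr_mono2) auto
    qed simp
    then show ?case by (simp add: prob_space)
  qed
  have "(\<lambda>n. C / real n) \<longlonglongrightarrow> 0"
    by (rule tendsto_divide_0[OF tendsto_const filterlim_at_top_imp_at_infinity[OF filterlim_real_sequentially]])
  then have "(\<lambda>n. C / real (n - M s)) \<longlonglongrightarrow> 0"
    by - (rule LIMSEQ_offset[where k = "M s"], simp)
  then show "(\<lambda>n. (C / real (n - M s)) powr p) \<longlonglongrightarrow> 0"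
    using p C tendsto_powr'[of "\<lambda>n. C / real (n - M s)" 0 sequentially "\<lambda>_. p" p] by simp
qed (auto intro!: always_eventually integral_nonneg_AE)

lemma norlund_mean_diff:
  assumes "integrable \<mu> f" "integrable \<mu> g"
  shows "norlund_mean m q (\<lambda>x. f x - g x) n x = norlund_mean m q f n x - norlund_mean m q g n x"
  using assms integrable_mult_\<psi>
  by (simp add: norlund_mean_def vilenkin_partial_sum_def vilenkin_coeff_def left_diff_distrib
      sum_subtractf right_diff_distrib)

lemma norlund_mean_power_tendsto:
  assumes B: "\<And>k. m k \<le> B" and p: "p \<ge> 1" and f: "f \<in> Lp_space \<mu> p"
    and q: "\<And>k. q k \<ge> 0" "decseq q" "q 0 > 0"
  shows "(\<lambda>n. LINT x|\<mu>. norm (norlund_mean m q f (M n) x - f x) powr p) \<longlonglongrightarrow> 0"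
proof (rule LIMSEQ_I)
  let ?E = "\<lambda>h. LINT x|\<mu>. norm (h x :: complex) powr p"
  let ?t = "\<lambda>h n. norlund_mean m q h (M n)"
  fix e :: real assume e: "e > 0"
  \<comment> \<open>\<open>D\<close> and \<open>D'\<close> collect the constants from two uses of
    \<open>Lp_power_diff_le\<close> and one of the uniform bound: \<open>D\<close> for the distance
    of \<open>f\<close> from \<open>g\<close>, \<open>D'\<close> for the error of the means of
    \<open>g\<close>.\<close>
  define D where "D = 2 powr p * ((3 * real B + 2) powr p + 2 powr p)"
  define D' where "D' = (2 powr p * 2 powr p :: real)"
  have D: "D > 0" and D': "D' > 0" by (simp_all add: D_def D'_def add_nonneg_pos)
  have "e / (2 * D) > 0" using e D by simp
  then obtain s g where g: "cyl s g" and fg: "?E (\<lambda>x. f x - g x) < e / (2 * D)"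
    using cyl_approx_Lp[OF p f] unfolding cyl_approx_def by blast
  have gL: "g \<in> Lp_space \<mu> p" by (rule cyl_in_Lp_space[OF g])
  have hL: "(\<lambda>x. f x - g x) \<in> Lp_space \<mu> p" by (rule Lp_space_diff[OF f gL p])
  have bound: "?E (\<lambda>x. ?t f n x - f x) \<le> D * ?E (\<lambda>x. f x - g x) + D' * ?E (\<lambda>x. ?t g n x - g x)" for n
  proof -
    let ?h = "\<lambda>x. f x - g x"
    \<comment> \<open>Known members are the difference of the mean of \<open>h = f - g\<close> and
      \<open>h\<close>, and \<open>g - f\<close>; subtracting the second from the first leaves the
      mean.\<close>
    have thL: "?t ?h n \<in> Lp_space \<mu> p"
      using Lp_space_diff[OF norlund_diff_in_Lp_space[OF m_ge2 p hL, of q "M n"]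
        Lp_space_diff[OF gL f p] p] by simp
    have tgL: "(\<lambda>x. g x - ?t g n x) \<in> Lp_space \<mu> p"
      using Lp_space_diff[OF cyl_in_Lp_space[OF cyl_const[of 0 0]]
        norlund_diff_in_Lp_space[OF m_ge2 p gL, of q "M n"] p] by simp
    \<comment> \<open>The decomposition is written with differences only, to match
      \<open>Lp_power_diff_le\<close>.\<close>
    have "?t f n x - f x = ?t ?h n x - (?h x - (?t g n x - g x))" for x
      using norlund_mean_diff[OF Lp_space_integrable[OF f p] Lp_space_integrable[OF gL p]] by (simp add: algebra_simps)
    then have "?E (\<lambda>x. ?t f n x - f x) = ?E (\<lambda>x. ?t ?h n x - (?h x - (?t g n x - g x)))"
      by (simp only:)
    also have "\<dots> \<le> 2 powr p * (?E (?t ?h n) + ?E (\<lambda>x. ?h x - (?t g n x - g x)))"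
      by (intro Lp_power_diff_le Lp_space_diff[OF hL] norlund_diff_in_Lp_space[OF m_ge2] p thL gL)
    also have "\<dots> \<le> 2 powr p * ((3 * real B + 2) powr p * ?E ?h
        + 2 powr p * (?E ?h + ?E (\<lambda>x. ?t g n x - g x)))"
      by (intro mult_left_mono add_mono norlund_mean_Lp_bound Lp_power_diff_le
          norlund_diff_in_Lp_space[OF m_ge2] p hL gL B q) auto
    also have "\<dots> = D * ?E ?h + D' * ?E (\<lambda>x. ?t g n x - g x)"
      by (simp add: D_def D'_def algebra_simps)
    finally show ?thesis .
  qed
  have "\<forall>\<^sub>F n in sequentially. ?E (\<lambda>x. ?t g n x - g x) < e / (2 * D')"
    using e D' by (intro order_tendstoD(2)[OF norlund_mean_cyl_tendsto[OF g p q]]) auto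
  then obtain N where N: "\<And>n. n \<ge> N \<Longrightarrow> ?E (\<lambda>x. ?t g n x - g x) < e / (2 * D')"
    by (auto simp: eventually_sequentially)
  have "?E (\<lambda>x. ?t f n x - f x) < e" if "n \<ge> N" for n
  proof -
    have "D * ?E (\<lambda>x. f x - g x) < e / 2" using fg D by (simp add: pos_less_divide_eq mult_ac)
    moreover have "D' * ?E (\<lambda>x. ?t g n x - g x) < e / 2"
      using N[OF that] D' by (simp add: pos_less_divide_eq mult_ac)
    ultimately show ?thesis using bound[of n] by linarith
  qed
  moreover have "?E (\<lambda>x. ?t f n x - f x) \<ge> 0" for n by (auto intro!: integral_nonneg_AE)
  ultimately show "\<exists>N. \<forall>n\<ge>N. norm (?E (\<lambda>x. ?t f n x - f x) - 0) < e" by auto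
qed

end

theorem theorem2p4p4:
  fixes m :: "nat \<Rightarrow> nat" and q :: "nat \<Rightarrow> real" and p :: real
    and f :: "(nat \<Rightarrow> nat) \<Rightarrow> complex"
  assumes "\<And>k. m k \<ge> 2" and "bdd_above (range m)"
    and "p \<ge> 1" and "f \<in> Lp_space (vilenkin_measure m) p"
    and "\<And>k. q k \<ge> 0" and "decseq q" and "q 0 > 0"
  shows "(\<lambda>n. Lp_norm (vilenkin_measure m) p
            (\<lambda>x. norlund_mean m q f (vilenkin_M m n) x - f x)) \<longlonglongrightarrow> 0"
proof -
  interpret vilenkin m by unfold_locales (rule assms(1))
  obtain B where B: "\<And>k. m k \<le> B" using assms(2) by (auto simp: bdd_above_def)
  \<comment> \<open>Taking p-th roots is continuous at 0 because the exponent \<open>1 / p\<close>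
    is positive.\<close>
  have "(\<lambda>n. (LINT x|\<mu>. norm (norlund_mean m q f (M n) x - f x) powr p) powr (1 / p)) \<longlonglongrightarrow> 0 powr (1 / p)"
    using assms(3)
    by (intro tendsto_powr' norlund_mean_power_tendsto[where B = B] B assms tendsto_const)
      (auto intro!: always_eventually integral_nonneg_AE)
  then show ?thesis by (simp add: Lp_norm_def)
qed

end
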